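(* The right tail of $W$ decays exponentially with rate $r^*$: $$-\log\mathbb P(W>x)\sim r^*x\qquad\text{as } x\to\infty,$$ where $f(x)\sim g(x)$ means $f(x)/g(x)\to1$.
   Context: Let $(\mathbf Z_n)_{n\ge 0}$ be the branching random walk on $\mathbb R_+^2$ started from a single particle at the origin, in which every particle of generation $n$ located at $y\in\mathbb R_+^2$ gives birth, independently of all other particles, to children located at $y+z$, where $z$ ranges over the atoms of an independent copy of a Poisson point process on $(0,\infty)^2$ whose intensity is Lebesgue measure $\mathrm dt\,\mathrm dx$; $\mathbf Z_n$ denotes the point measure of positions of generation $n$. Set $W_n=\int e^{-t-x}\,\mathbf Z_n(\mathrm dt,\mathrm dx)$; $(W_n)_{n\ge0}$ is a nonnegative martingale of mean $1$ converging almost surely and in $L^1$ to a limit $W$ with $\mathbb E W=1$. Define $$r^*=\exp\Big(\int_0^\infty\Big(\big(2(e^u-u-1)\big)^{-1/2}-u^{-1}\mathbf 1_{\{u<1\}}\Big)\mathrm du\Big)\in(0,\infty).$$ *)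

theory Defs
  imports "HOL-Probability.Probability"
begin

definition quadrant :: "(real \<times> real) set" where
  "quadrant = {0<..} \<times> {0<..}"

text \<open>Number of atoms (with multiplicity) of the point measure sum_k delta_(p k) lying in A.\<close>
definition pcount :: "(nat \<Rightarrow> 'b) \<Rightarrow> 'b set \<Rightarrow> nat" where
  "pcount p A = card {k. p k \<in> A}"

text \<open>xi is a Poisson point process on (0,oo)^2 with intensity Lebesgue measure dt dx,
  represented as the point measure sum_k delta_(xi k omega) (atoms listed with multiplicity).\<close>
definition poisson_pp_quadrant :: "'a measure \<Rightarrow> (nat \<Rightarrow> 'a \<Rightarrow> real \<times> real) \<Rightarrow> bool" where
  "poisson_pp_quadrant M xi \<longleftrightarrow>
     (\<lambda>\<omega> k. xi k \<omega>) \<in> M \<rightarrow>\<^sub>M PiM UNIV (\<lambda>_. borel) \<and>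
     (AE \<omega> in M. \<forall>k. xi k \<omega> \<in> quadrant) \<and>
     (\<forall>A. A \<in> sets borel \<and> A \<subseteq> quadrant \<and> emeasure lborel A < \<infinity> \<longrightarrow>
        (AE \<omega> in M. finite {k. xi k \<omega> \<in> A}) \<and>
        (\<forall>n::nat. measure M {\<omega> \<in> space M. pcount (\<lambda>k. xi k \<omega>) A = n}
                 = measure lborel A ^ n / fact n * exp (- measure lborel A))) \<and>
     (\<forall>(J::nat set) (B::nat \<Rightarrow> (real \<times> real) set). finite J \<longrightarrow> disjoint_family_on B J \<longrightarrow>
        (\<forall>j\<in>J. B j \<in> sets borel \<and> B j \<subseteq> quadrant \<and> emeasure lborel (B j) < \<infinity>) \<longrightarrow>
        prob_space.indep_vars M (\<lambda>_. count_space UNIV) (\<lambda>j \<omega>. pcount (\<lambda>k. xi k \<omega>) (B j)) J)"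

text \<open>Ulam-Harris labelling: particle u = [k_1,...,k_n] is the k_n-th child of [k_1,...,k_(n-1)];
  xi v is the point process of displacements of the children of v.
  Position of particle u.\<close>
definition brw_pos :: "(nat list \<Rightarrow> nat \<Rightarrow> 'a \<Rightarrow> real \<times> real) \<Rightarrow> nat list \<Rightarrow> 'a \<Rightarrow> real \<times> real" where
  "brw_pos xi u \<omega> = (\<Sum>i<length u. xi (take i u) (u ! i) \<omega>)"

text \<open>W_n = integral of exp(-t-x) against Z_n (a nonnegative, a priori extended-real sum).\<close>
definition brw_W :: "(nat list \<Rightarrow> nat \<Rightarrow> 'a \<Rightarrow> real \<times> real) \<Rightarrow> nat \<Rightarrow> 'a \<Rightarrow> ennreal" where
  "brw_W xi n \<omega> = (\<integral>\<^sup>+ u. ennreal (exp (- (fst (brw_pos xi u \<omega>) + snd (brw_pos xi u \<omega>))))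
                        \<partial>count_space {u. length u = n})"

definition r_star :: real where
  "r_star = exp (LINT u:{0<..}|lborel.
      (1 / sqrt (2 * (exp u - u - 1)) - (if u < 1 then 1 / u else 0)))"

end

theory Submission
  imports Defs "HOL-Real_Asymp.Real_Asymp"
begin

text \<open>
  By Campbell's formula for the Poisson process, the cumulant function
  h(\<tau>) = log E exp(e^\<tau> W) satisfies
  h(\<tau>) = \<integral>\<integral> (exp (h(\<tau> - x - y)) - 1) dx dy over the quadrant, that is h'' = e^h - 1.
  With h(\<tau>) ~ e^\<tau> at minus infinity, conservation of energy gives h' = sqrt (2 (e^h - h - 1)).
  Separating variables, h blows up exactly at \<tau> = log r*, and
  E exp(s W) ~ 2 r*^2 / (r* - s)^2 as s increases to r*. The equation holds first for the increasing
  limit of log E exp(e^\<tau> W_n); it is identified with the explicit solution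
  by a weighted contraction.
  The Chernoff bound gives the upper estimate for P(W > x); the lower one follows from Karamata's
  Tauberian argument, applied to the measure e^(r* w) P(W \<in> dw).
\<close>

section \<open>The exponential function on the extended nonnegative reals\<close>

text \<open>Writing the argument of the generating function as e^\<tau> turns the factor e^(-t-x)
  into a shift of \<tau>, so the equation is autonomous. Hence every shift of a solution is again a
  solution, and the place of the blow-up is decided only by the normalization h(\<tau>) ~ e^\<tau>.
  It expresses E W = 1, and it is the origin of the term 1/u removed on u < 1 in r*. Exponential
  moments may be infinite, so the identities for W_n are proved in [0, \<infinity>] for every
  \<tau>, by monotone convergence alone; finiteness below log r* is then a conclusion, obtained by
  comparing the iterates with the explicit solution. This comparison is one-sided. Equality comes
  from the weights e^(k \<tau>): the integral operator divides them by k^2, while e^h - 1 has slope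
  e^h, and the gap to be closed is O(e^(2 \<tau>)) near minus infinity. The factor 2 r*^2 in the
  blow-up arises because h' ~ sqrt 2 e^(h/2) for large h, so that e^(-h/2) vanishes linearly at
  r*.\<close>

definition em1 :: "ennreal \<Rightarrow> ennreal" where
  "em1 w = (if w = \<top> then \<top> else ennreal (exp (enn2real w) - 1))"

text \<open>Built from \<open>em1\<close> rather than conversely: e^w - 1 is the integrand in
  Campbell's formula, and this order avoids subtraction in \<open>ennreal\<close>.\<close>

definition eexp :: "ennreal \<Rightarrow> ennreal" where
  "eexp w = 1 + em1 w"

lemma em1_ennreal [simp]: "0 \<le> r \<Longrightarrow> em1 (ennreal r) = ennreal (exp r - 1)"
  by (simp add: em1_def)

lemma em1_top [simp]: "em1 \<top> = \<top>"
  by (simp add: em1_def)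

lemma em1_0 [simp]: "em1 0 = 0"
  by (simp add: em1_def)

lemma eexp_0 [simp]: "eexp 0 = 1"
  by (simp add: eexp_def)

lemma eexp_top [simp]: "eexp \<top> = \<top>"
  by (simp add: eexp_def)

lemma eexp_ennreal [simp]: "0 \<le> r \<Longrightarrow> eexp (ennreal r) = ennreal (exp r)"
  by (simp add: eexp_def flip: ennreal_1 ennreal_plus)

lemma le_em1: "w \<le> em1 w"
  by (cases w) (use exp_ge_add_one_self in \<open>auto intro!: ennreal_leI simp: algebra_simps\<close>)

lemma em1_mono: "v \<le> w \<Longrightarrow> em1 v \<le> em1 w"
  by (cases v; cases w) (auto intro!: ennreal_leI simp: top_unique)

lemma eexp_mono: "v \<le> w \<Longrightarrow> eexp v \<le> eexp w"
  unfolding eexp_def by (intro add_left_mono em1_mono)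

lemma eexp_add: "eexp (v + w) = eexp v * eexp w"
proof (cases "v = \<top> \<or> w = \<top>")
  case True
  have "eexp u \<noteq> 0" for u
    by (simp add: eexp_def)
  with True show ?thesis
    by (auto simp: ennreal_top_mult ennreal_mult_top)
next
  case False
  then obtain a b where "v = ennreal a" "w = ennreal b" "a \<ge> 0" "b \<ge> 0"
    by (cases v; cases w) auto
  then show ?thesis
    by (simp add: exp_add ennreal_mult flip: ennreal_plus)
qed

lemma eexp_sum: "eexp (\<Sum>i\<in>I. f i) = (\<Prod>i\<in>I. eexp (f i))"
  by (induction I rule: infinite_finite_induct) (auto simp: eexp_add)

lemma tendsto_em1:
  assumes f: "(f \<longlongrightarrow> ennreal r) F" and r: "0 \<le> r"
  shows "((\<lambda>x. em1 (f x)) \<longlongrightarrow> em1 (ennreal r)) F"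
proof -
  have "eventually (\<lambda>x. f x < \<top>) F"
    using f by (rule order_tendstoD) simp
  then have ev: "eventually (\<lambda>x. ennreal (exp (enn2real (f x)) - 1) = em1 (f x)) F"
    by eventually_elim (auto simp: em1_def)
  have "((\<lambda>x. ennreal (exp (enn2real (f x)) - 1)) \<longlongrightarrow> ennreal (exp r - 1)) F"
    by (intro tendsto_ennrealI tendsto_diff tendsto_exp tendsto_const tendsto_enn2real f r)
  then show ?thesis
    unfolding em1_ennreal[OF r] by (rule Lim_transform_eventually[OF _ ev])
qed

lemma tendsto_eexp:
  assumes "(f \<longlongrightarrow> ennreal r) F" "0 \<le> r"
  shows "((\<lambda>x. eexp (f x)) \<longlongrightarrow> eexp (ennreal r)) F"
  unfolding eexp_def by (intro tendsto_add tendsto_const tendsto_em1 assms)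

text \<open>At a finite supremum this is continuity; at the supremum \<open>\<top>\<close> the
  comparison \<open>le_em1\<close> forces both sides to be \<open>\<top>\<close>.\<close>

lemma em1_SUP:
  fixes f :: "nat \<Rightarrow> ennreal"
  assumes "incseq f"
  shows "em1 (SUP i. f i) = (SUP i. em1 (f i))"
proof (cases "(SUP i. f i) = \<top>")
  case True
  have "(SUP i. f i) \<le> (SUP i. em1 (f i))"
    by (intro SUP_mono') (rule le_em1)
  then have "(SUP i. em1 (f i)) = \<top>"
    unfolding True by (simp only: top_unique)
  then show ?thesis
    unfolding True em1_top by (rule sym)
next
  case False
  then obtain S where S: "(SUP i. f i) = ennreal S" "0 \<le> S"
    by (cases "SUP i. f i") auto
  have "incseq (\<lambda>i. em1 (f i))"
    using assms by (auto simp: incseq_def intro: em1_mono)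
  moreover have "f \<longlonglongrightarrow> ennreal S"
    using LIMSEQ_SUP[OF assms] S by simp
  then have "(\<lambda>i. em1 (f i)) \<longlonglongrightarrow> em1 (SUP i. f i)"
    unfolding S(1) using S(2) by (rule tendsto_em1)
  ultimately show ?thesis
    using LIMSEQ_SUP LIMSEQ_unique by blast
qed

lemma eexp_SUP:
  fixes f :: "nat \<Rightarrow> ennreal"
  assumes "incseq f"
  shows "eexp (SUP i. f i) = (SUP i. eexp (f i))"
  unfolding eexp_def em1_SUP[OF assms]
  using ennreal_SUP_add_right[of UNIV 1 "\<lambda>i. em1 (f i)"] by simp

text \<open>The exponential of a series becomes a supremum of finite products. As all factors are at
  least 1 the products increase, and expectations can be computed with finitely many
  children.\<close>

lemma eexp_suminf: "eexp (\<Sum>i. f i) = (SUP n. \<Prod>i<n. eexp (f i))"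
proof -
  have "(\<Sum>i. f i) = (SUP n. \<Sum>i<n. f i)"
    by (rule suminf_eq_SUP)
  moreover have "incseq (\<lambda>n. \<Sum>i<n. f i)"
    by (auto simp: incseq_def intro!: sum_mono2)
  ultimately show ?thesis
    by (simp add: eexp_SUP eexp_sum)
qed

lemma borel_measurable_em1 [measurable]: "em1 \<in> borel_measurable borel"
  unfolding em1_def by measurable

lemma borel_measurable_eexp [measurable]: "eexp \<in> borel_measurable borel"
  unfolding eexp_def by measurable

section \<open>Exponential moments of a Poisson process\<close>

text \<open>Finiteness matters: \<open>pcount\<close> is a \<open>card\<close>, hence 0 when
  infinitely many indices fall into A, whereas the series is then \<open>\<top>\<close>.\<close>

lemma suminf_indicator_eq_pcount:
  assumes "finite {k. p k \<in> A}"
  shows "(\<Sum>k. indicator A (p k)) = (of_nat (pcount p A) :: ennreal)"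
proof -
  have "(\<Sum>k. indicator A (p k) :: ennreal) = (\<Sum>k\<in>{k. p k \<in> A}. indicator A (p k))"
    by (rule suminf_finite[OF assms]) auto
  also have "\<dots> = of_nat (pcount p A)"
    by (simp add: pcount_def)
  finally show ?thesis .
qed

lemma (in prob_space) nn_integral_exp_poisson:
  fixes N :: "'a \<Rightarrow> nat"
  assumes [measurable]: "N \<in> M \<rightarrow>\<^sub>M count_space UNIV" and "0 \<le> m" "0 \<le> c"
    and N: "\<And>n. measure M {\<omega> \<in> space M. N \<omega> = n} = m ^ n / fact n * exp (- m)"
  shows "(\<integral>\<^sup>+\<omega>. eexp (ennreal c * of_nat (N \<omega>)) \<partial>M) = eexp (em1 (ennreal c) * ennreal m)"
proof -
  have *: "eexp (ennreal c * of_nat n) = ennreal (exp c ^ n)" for n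
  proof -
    have "ennreal c * of_nat n = ennreal (real n * c)"
      using \<open>0 \<le> c\<close> by (simp add: ennreal_of_nat_eq_real_of_nat ennreal_mult mult.commute)
    then show ?thesis
      using \<open>0 \<le> c\<close> by (simp add: exp_of_nat_mult)
  qed
  have "(\<integral>\<^sup>+\<omega>. eexp (ennreal c * of_nat (N \<omega>)) \<partial>M)
      = (\<integral>\<^sup>+\<omega>. (\<Sum>n. ennreal (exp c ^ n) * indicator {\<omega> \<in> space M. N \<omega> = n} \<omega>) \<partial>M)"
  proof (intro nn_integral_cong)
    fix \<omega> assume "\<omega> \<in> space M"
    have "(\<Sum>n. ennreal (exp c ^ n) * indicator {\<omega> \<in> space M. N \<omega> = n} \<omega>)
      = (\<Sum>n\<in>{N \<omega>}. ennreal (exp c ^ n) * indicator {\<omega> \<in> space M. N \<omega> = n} \<omega>)"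
      by (rule suminf_finite) (auto simp: indicator_def)
    then show "eexp (ennreal c * of_nat (N \<omega>))
        = (\<Sum>n. ennreal (exp c ^ n) * indicator {\<omega> \<in> space M. N \<omega> = n} \<omega>)"
      using \<open>\<omega> \<in> space M\<close> by (simp add: *)
  qed
  also have "\<dots> = (\<Sum>n. ennreal (exp c ^ n) * emeasure M {\<omega> \<in> space M. N \<omega> = n})"
    by (subst nn_integral_suminf) (auto simp: nn_integral_cmult_indicator)
  also have "\<dots> = (\<Sum>n. ennreal ((m * exp c) ^ n / fact n * exp (- m)))"
    using \<open>0 \<le> m\<close>
    by (intro suminf_cong) (auto simp: emeasure_eq_measure N power_mult_distrib field_simps simp
        flip: ennreal_mult)
  also have "\<dots> = ennreal (exp (m * exp c) * exp (- m))"
  proof (rule suminf_ennreal_eq)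
    show "(\<lambda>n. (m * exp c) ^ n / fact n * exp (- m)) sums (exp (m * exp c) * exp (- m))"
      using exp_converges[of "m * exp c"]
          by (intro sums_mult2) (simp add: divide_inverse mult.commute)
  qed (use \<open>0 \<le> m\<close> in auto)
  also have "\<dots> = eexp (em1 (ennreal c) * ennreal m)"
    using \<open>0 \<le> m\<close> \<open>0 \<le> c\<close> mult_left_mono[of 1 "exp c" m]
    by (simp add: algebra_simps flip: ennreal_mult exp_add)
  finally show ?thesis .
qed

text \<open>Measurability of a count is contained in the independence clause, read for a one-element
  index set.\<close>

lemma poisson_pp_count_measurable:
  assumes "prob_space M" "poisson_pp_quadrant M X"
    and "B \<in> sets borel" "B \<subseteq> quadrant" "emeasure lborel B < \<infinity>"
  shows "(\<lambda>\<omega>. pcount (\<lambda>k. X k \<omega>) B) \<in> M \<rightarrow>\<^sub>M count_space UNIV"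
proof -
  interpret prob_space M by fact
  have "indep_vars (\<lambda>_. count_space UNIV) (\<lambda>j \<omega>. pcount (\<lambda>k. X k \<omega>) ((\<lambda>_. B) j)) {0::nat}"
    using assms(2-) unfolding poisson_pp_quadrant_def
    by (elim conjE allE[where x="{0::nat}"]) (auto simp: disjoint_family_on_def)
  then show ?thesis
    by (simp add: indep_vars_def)
qed

lemma poisson_pp_measurable:
  assumes "poisson_pp_quadrant M X"
  shows "X k \<in> M \<rightarrow>\<^sub>M borel"
proof -
  have "(\<lambda>\<omega> k. X k \<omega>) \<in> M \<rightarrow>\<^sub>M PiM UNIV (\<lambda>_. borel)"
    using assms by (simp add: poisson_pp_quadrant_def)
  from measurable_compose[OF this measurable_component_singleton[of k]] show ?thesis
    by simp
qed

text \<open>For a step function the sum over atoms is a linear combination of counts of disjoint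
  sets. The exponential factorizes by independence, and each factor is a Poisson generating
  function.\<close>

lemma poisson_campbell_step:
  assumes M: "prob_space M" and X: "poisson_pp_quadrant M X"
    and J: "finite (J :: nat set)" "disjoint_family_on B J"
    and B: "\<And>j. j \<in> J \<Longrightarrow> B j \<in> sets borel \<and> B j \<subseteq> quadrant \<and> emeasure lborel (B j) < \<infinity>"
    and c: "\<And>j. j \<in> J \<Longrightarrow> 0 \<le> c j"
  shows "(\<integral>\<^sup>+\<omega>. eexp (\<Sum>k. \<Sum>j\<in>J. ennreal (c j) * indicator (B j) (X k \<omega>)) \<partial>M)
       = eexp (\<Sum>j\<in>J. em1 (ennreal (c j)) * emeasure lborel (B j))"
proof -
  interpret prob_space M by fact
  let ?N = "\<lambda>j \<omega>. pcount (\<lambda>k. X k \<omega>) (B j)"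
  have "AE \<omega> in M. finite {k. X k \<omega> \<in> B j}" if "j \<in> J" for j
    using X B[OF that] unfolding poisson_pp_quadrant_def by blast
  then have "AE \<omega> in M. \<forall>j\<in>J. finite {k. X k \<omega> \<in> B j}"
    using J(1) by (intro AE_finite_allI) auto
  then have "AE \<omega> in M. eexp (\<Sum>k. \<Sum>j\<in>J. ennreal (c j) * indicator (B j) (X k \<omega>))
      = (\<Prod>j\<in>J. eexp (ennreal (c j) * of_nat (?N j \<omega>)))"
  proof eventually_elim
    case (elim \<omega>)
    have "(\<Sum>k. \<Sum>j\<in>J. ennreal (c j) * indicator (B j) (X k \<omega>))
        = (\<Sum>j\<in>J. ennreal (c j) * (\<Sum>k. indicator (B j) (X k \<omega>)))"
      by (subst suminf_sum) auto
    also have "\<dots> = (\<Sum>j\<in>J. ennreal (c j) * of_nat (?N j \<omega>))"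
      using elim by (intro sum.cong) (auto simp: suminf_indicator_eq_pcount)
    finally show ?case
      by (simp add: eexp_sum)
  qed
  then have "(\<integral>\<^sup>+\<omega>. eexp (\<Sum>k. \<Sum>j\<in>J. ennreal (c j) * indicator (B j) (X k \<omega>)) \<partial>M)
      = (\<integral>\<^sup>+\<omega>. (\<Prod>j\<in>J. eexp (ennreal (c j) * of_nat (?N j \<omega>))) \<partial>M)"
    by (rule nn_integral_cong_AE)
  also have "\<dots> = (\<Prod>j\<in>J. \<integral>\<^sup>+\<omega>. eexp (ennreal (c j) * of_nat (?N j \<omega>)) \<partial>M)"
  proof (rule indep_vars_nn_integral[OF J(1)])
    have "indep_vars (\<lambda>_. count_space UNIV) ?N J"
      using X J B unfolding poisson_pp_quadrant_def by blast
    then show "indep_vars (\<lambda>_. borel) (\<lambda>j \<omega>. eexp (ennreal (c j) * of_nat (?N j \<omega>))) J"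
      by (rule indep_vars_compose2[where Y="\<lambda>j n. eexp (ennreal (c j) * of_nat n)"]) auto
  qed auto
  also have "\<dots> = (\<Prod>j\<in>J. eexp (em1 (ennreal (c j)) * emeasure lborel (B j)))"
  proof (intro prod.cong refl)
    fix j assume j: "j \<in> J"
    have "emeasure lborel (B j) = ennreal (measure lborel (B j))"
      using B[OF j] by (simp add: emeasure_eq_ennreal_measure less_top)
    moreover have "measure M {\<omega> \<in> space M. ?N j \<omega> = n}
        = measure lborel (B j) ^ n / fact n * exp (- measure lborel (B j))" for n
      using X B[OF j] unfolding poisson_pp_quadrant_def by blast
    ultimately show "(\<integral>\<^sup>+\<omega>. eexp (ennreal (c j) * of_nat (?N j \<omega>)) \<partial>M)
        = eexp (em1 (ennreal (c j)) * emeasure lborel (B j))"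
      using nn_integral_exp_poisson[OF poisson_pp_count_measurable[OF M X, of "B j"], of "measure
          lborel (B j)" "c j"] B[OF j] c[OF j]
      by simp
  qed
  finally show ?thesis
    by (simp add: eexp_sum)
qed

lemma poisson_campbell_simple:
  assumes M: "prob_space M" and X: "poisson_pp_quadrant M X"
    and g: "simple_function borel g" and fin: "\<And>z. g z < \<top>"
    and supp: "A \<in> sets borel" "A \<subseteq> quadrant" "emeasure lborel A < \<infinity>" "\<And>z. z \<notin> A \<Longrightarrow> g z = 0"
  shows "(\<integral>\<^sup>+\<omega>. eexp (\<Sum>k. g (X k \<omega>)) \<partial>M) = eexp (\<integral>\<^sup>+z. em1 (g z) \<partial>lborel)"
proof -
  define V where "V = range g - {0}"
  have "finite V"
    using simple_functionD(1)[OF g] by (simp add: V_def)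
  then obtain e and n :: nat where e: "bij_betw e {..<n} V"
    using ex_bij_betw_nat_finite[of V] by (auto simp: atLeast0LessThan)
  define B where "B j = g -` {e j}" for j
  have B_sets: "B j \<in> sets borel" for j
    using simple_functionD(2)[OF g, of "{e j}"] by (simp add: B_def)
  have eV: "e j \<in> V" if "j < n" for j
    using e that by (auto simp: bij_betw_def)
  have BA: "B j \<subseteq> A" if "j < n" for j
    using eV[OF that] supp(4) by (force simp: B_def V_def)
  have B: "B j \<in> sets borel \<and> B j \<subseteq> quadrant \<and> emeasure lborel (B j) < \<infinity>" if "j \<in> {..<n}" for j
    using BA[of j] B_sets that supp(1-3) le_less_trans[OF emeasure_mono[of "B j" A lborel]]
    by (auto simp: less_top)
  have disj: "disjoint_family_on B {..<n}"
    using e by (auto simp: disjoint_family_on_def B_def bij_betw_def dest: inj_onD)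
  have e_fin: "ennreal (enn2real (e j)) = e j" if "j < n" for j
    using eV[OF that] fin by (auto simp: V_def)
  \<comment> \<open>Stated for any F with F 0 = 0, since it serves twice: for the identity inside
    the exponent, and for \<open>em1\<close> inside the integral.\<close>
  have decomp: "F (g z) = (\<Sum>j<n. F (ennreal (enn2real (e j))) * indicator (B j) z)" if "F 0
      = 0" for z and F :: "ennreal \<Rightarrow> ennreal"
  proof (cases "g z = 0")
    case True
    then have "z \<notin> B j" if "j < n" for j
      using eV[OF that] by (auto simp: B_def V_def)
    then show ?thesis
      using True that by simp
  next
    case False
    then obtain i where i: "i < n" "g z = e i"
      using e by (auto simp: bij_betw_def V_def image_iff)
    then have "z \<in> B j \<longleftrightarrow> j = i" if "j < n" for j
      using e that by (auto simp: B_def bij_betw_def dest: inj_onD)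
    then have "(\<Sum>j<n. F (ennreal (enn2real (e j))) * indicator (B j) z) = (\<Sum>j<n. if j
        = i then F (e i) else 0)"
      using e_fin by (intro sum.cong) (auto simp: indicator_def)
    then show ?thesis
      using i by simp
  qed
  have "(\<integral>\<^sup>+\<omega>. eexp (\<Sum>k. g (X k \<omega>)) \<partial>M)
      = (\<integral>\<^sup>+\<omega>. eexp (\<Sum>k. \<Sum>j<n. ennreal (enn2real (e j)) * indicator (B j) (X k \<omega>)) \<partial>M)"
    using decomp[of "\<lambda>x. x"] by simp
  also have "\<dots> = eexp (\<Sum>j<n. em1 (ennreal (enn2real (e j))) * emeasure lborel (B j))"
    by (rule poisson_campbell_step[OF M X _ disj B]) auto
  also have "(\<Sum>j<n. em1 (ennreal (enn2real (e j))) * emeasure lborel (B j))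
      = (\<integral>\<^sup>+z. (\<Sum>j<n. em1 (ennreal (enn2real (e j))) * indicator (B j) z) \<partial>lborel)"
    using B_sets by (subst nn_integral_sum) (auto simp: nn_integral_cmult_indicator simp del:
        em1_ennreal)
  also have "\<dots> = (\<integral>\<^sup>+z. em1 (g z) \<partial>lborel)"
    using decomp[of em1] by simp
  finally show ?thesis .
qed

text \<open>\<open>eexp\<close> and \<open>em1\<close> commute with increasing suprema, so both
  sides pass to the limit along simple functions, whether the values are finite or not.\<close>

lemma poisson_campbell:
  assumes M: "prob_space M" and X: "poisson_pp_quadrant M X" and g: "g \<in> borel_measurable borel"
  shows "(\<integral>\<^sup>+\<omega>. eexp (\<Sum>k. g (X k \<omega>)) \<partial>M) = eexp (\<integral>\<^sup>+z\<in>quadrant. em1 (g z) \<partial>lborel)"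
proof -
  obtain U where U: "\<And>i. simple_function borel (U i)" "incseq U" "\<And>i z. U i z < \<top>" "\<And>z. (SUP i. U i
      z) = g z"
    using borel_measurable_implies_simple_function_sequence'[OF g] by blast
  \<comment> \<open>Cutting off to bounded boxes gives the approximants supports of finite area; the
    boxes exhaust the quadrant, which carries almost surely all atoms.\<close>
  define A :: "nat \<Rightarrow> (real \<times> real) set" where "A i = {0<..real i} \<times> {0<..real i}" for i
  have A_sets [measurable]: "A i \<in> sets borel" for i
    unfolding A_def borel_prod[symmetric] by (intro pair_measureI) auto
  have A: "A i \<subseteq> quadrant" "emeasure lborel (A i) < \<infinity>" for i
    by (auto simp: A_def quadrant_def lborel_prod[symmetric] lborel.emeasure_pair_measure_Times
        ennreal_mult_less_top simp flip: ennreal_mult)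
  define G where "G i z = U i z * indicator (A i) z" for i z
  have G_simple: "simple_function borel (G i)" for i
    unfolding G_def using U(1) by (intro simple_function_mult simple_function_indicator) auto
  have [measurable]: "G i \<in> borel_measurable borel" for i
    by (rule borel_measurable_simple_function[OF G_simple])
  have G_mono: "incseq (\<lambda>i. G i z)" for z
    unfolding G_def using U(2) by (auto simp: incseq_def le_fun_def A_def indicator_def)
  have G_le: "G m z \<le> G n z" if "m \<le> n" for m n z
    using G_mono that by (auto simp: incseq_def)
  have G_sup: "(SUP i. G i z) = g z * indicator quadrant z" for z
  proof (cases "z \<in> quadrant")
    case True
    obtain m where m: "fst z \<le> real m" "snd z \<le> real m"
      using real_arch_simple[of "max (fst z) (snd z)"] by auto
    have "(SUP i. G i z) = (SUP i. U i z)"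
    proof (rule antisym)
      show "(SUP i. G i z) \<le> (SUP i. U i z)"
        by (intro SUP_mono') (auto simp: G_def indicator_def)
      have "U i z \<le> G (max i m) z" for i
        using U(2) m True by (cases z) (auto simp: G_def A_def incseq_def le_fun_def quadrant_def
            max_def)
      then show "(SUP i. U i z) \<le> (SUP i. G i z)"
        by (intro SUP_mono) blast
    qed
    then show ?thesis
      using True U(4) by simp
  next
    case False
    then have "G i z = 0" for i
      using A(1)[of i] by (auto simp: G_def indicator_def)
    then show ?thesis
      using False by simp
  qed
  have [measurable]: "X k \<in> M \<rightarrow>\<^sub>M borel" for k
    by (rule poisson_pp_measurable[OF X])
  have "AE \<omega> in M. \<forall>k. X k \<omega> \<in> quadrant"
    using X by (simp add: poisson_pp_quadrant_def)
  then have "AE \<omega> in M. eexp (\<Sum>k. g (X k \<omega>)) = (SUP i. eexp (\<Sum>k. G i (X k \<omega>)))"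
  proof eventually_elim
    case (elim \<omega>)
    then have "(\<Sum>k. g (X k \<omega>)) = (\<Sum>k. SUP i. G i (X k \<omega>))"
      by (simp add: G_sup)
    also have "\<dots> = (SUP i. \<Sum>k. G i (X k \<omega>))"
      using G_mono by (rule ennreal_suminf_SUP_eq)
    finally show ?case
      using G_mono by (simp add: eexp_SUP incseq_def suminf_le)
  qed
  then have "(\<integral>\<^sup>+\<omega>. eexp (\<Sum>k. g (X k \<omega>)) \<partial>M) = (\<integral>\<^sup>+\<omega>. (SUP i. eexp (\<Sum>k. G i (X k \<omega>))) \<partial>M)"
    by (rule nn_integral_cong_AE)
  also have "\<dots> = (SUP i. \<integral>\<^sup>+\<omega>. eexp (\<Sum>k. G i (X k \<omega>)) \<partial>M)"
    by (intro nn_integral_monotone_convergence_SUP)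
      (auto simp: incseq_def intro!: le_funI eexp_mono suminf_le G_le)
  also have "\<dots> = (SUP i. eexp (\<integral>\<^sup>+z. em1 (G i z) \<partial>lborel))"
    by (intro SUP_cong refl poisson_campbell_simple[OF M X G_simple _ A_sets A])
      (auto simp: G_def U(3) indicator_def)
  also have "\<dots> = eexp (SUP i. \<integral>\<^sup>+z. em1 (G i z) \<partial>lborel)"
    using G_mono by (subst eexp_SUP) (auto simp: incseq_def intro!: nn_integral_mono em1_mono)
  also have "(SUP i. \<integral>\<^sup>+z. em1 (G i z) \<partial>lborel) = (\<integral>\<^sup>+z. (SUP i. em1 (G i z)) \<partial>lborel)"
    using G_mono by (intro nn_integral_monotone_convergence_SUP[symmetric])
      (auto simp: incseq_def le_fun_def intro!: em1_mono)
  also have "\<dots> = (\<integral>\<^sup>+z\<in>quadrant. em1 (g z) \<partial>lborel)"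
    using G_mono by (intro nn_integral_cong) (simp add: G_sup indicator_def flip: em1_SUP)
  finally show ?thesis .
qed

section \<open>The differential equation\<close>

text \<open>The value of \<open>h'\<close> on the zero energy curve of \<open>h'' = e^h - 1\<close>, as a function of \<open>h\<close>.\<close>

definition speed :: "real \<Rightarrow> real" where
  "speed u = sqrt (2 * (exp u - u - 1))"

text \<open>\<open>-1/6\<close> is the limit of \<open>1 / speed w - 1 / w\<close> as \<open>w\<close> tends to 0.\<close>

definition speed_gap :: "real \<Rightarrow> real" where
  "speed_gap w = (if w = 0 then - 1 / 6 else 1 / speed w - 1 / w)"

text \<open>The time at which the solution with \<open>h(\<tau>) ~ e^\<tau>\<close> at minus infinity reaches the level \<open>u\<close>;
  splitting off \<open>ln u\<close> makes the integral converge at 0.\<close>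

definition log_time :: "real \<Rightarrow> real" where
  "log_time u = ln u + integral {0..u} speed_gap"

lemma exp_minus_affine_ge: "0 \<le> u \<Longrightarrow> u\<^sup>2 / 2 \<le> exp u - u - (1::real)"
  using exp_lower_Taylor_quadratic[of u] by simp

lemma speed_0 [simp]: "speed 0 = 0"
  by (simp add: speed_def)

text \<open>This comparison with the linearized motion h' = h yields the sign of
  \<open>speed_gap\<close>, then \<open>log_time u \<le> ln u\<close>, and finally
  \<open>exp t \<le> cumulant t\<close>.\<close>

lemma speed_ge: "0 \<le> u \<Longrightarrow> u \<le> speed u"
  unfolding speed_def using exp_minus_affine_ge[of u]
      by (intro real_le_rsqrt) (simp add: algebra_simps)

lemma speed_pos: "0 < u \<Longrightarrow> 0 < speed u"
  using speed_ge[of u] by simp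

lemma continuous_on_speed: "continuous_on A speed"
  unfolding speed_def by (intro continuous_intros)

lemma borel_measurable_speed [measurable]: "speed \<in> borel_measurable borel"
  by (rule borel_measurable_continuous_onI[OF continuous_on_speed])

lemma DERIV_speed: "0 < u \<Longrightarrow> (speed has_real_derivative (exp u - 1) / speed u) (at u)"
  using speed_pos[of u] exp_minus_affine_ge[of u] unfolding speed_def
  by (auto intro!: derivative_eq_intros simp: field_simps)

lemma inverse_speed_le: "1 \<le> u \<Longrightarrow> 1 / speed u \<le> 2 * exp (- u / 2)"
proof -
  assume u: "1 \<le> u"
  \<comment> \<open>This and the next bound, where 5/2 comes from e \<ge> 1 + 1 + 1/2, give u + 1
    \<le> 2u \<le> (4/5) e^u, which is below the (7/8) e^u required.\<close>
  have "u \<le> exp (u - 1)"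
    using exp_ge_add_one_self[of "u - 1"] by simp
  moreover have "(5/2) * exp (u - 1) \<le> exp u"
    using exp_lower_Taylor_quadratic[of 1] by (simp add: exp_diff field_simps)
  ultimately have "exp u / 4 \<le> 2 * (exp u - u - 1)"
    using u by simp
  then have "sqrt (exp u / 4) \<le> speed u"
    unfolding speed_def by (rule real_sqrt_le_mono)
  moreover have "sqrt (exp u / 4) = exp (u / 2) / 2"
    by (intro real_sqrt_unique) (auto simp: power2_eq_square simp flip: exp_add)
  ultimately have "exp (u / 2) / 2 \<le> speed u"
    by simp
  then have "1 / speed u \<le> 1 / (exp (u / 2) / 2)"
    by (intro divide_left_mono mult_pos_pos) (use u speed_pos[of u] in auto)
  then show "1 / speed u \<le> 2 * exp (- u / 2)"
    by (simp add: exp_minus field_simps)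
qed

text \<open>Only the point 0 is in question: there speed w = w + w^2/6 + ..., so the poles of 1 /
  speed w and 1 / w cancel.\<close>

lemma continuous_on_speed_gap: "continuous_on {0..} speed_gap"
proof -
  have "(speed_gap \<longlongrightarrow> - 1 / 6) (at_right 0)"
  proof (rule Lim_transform_eventually)
    show "((\<lambda>w. 1 / sqrt (2 * (exp w - w - 1)) - 1 / w) \<longlongrightarrow> - 1 / 6) (at_right (0::real))"
      by real_asymp
    show "eventually (\<lambda>w. 1 / sqrt (2 * (exp w - w - 1)) - 1 / w = speed_gap w) (at_right 0)"
      by (auto simp: speed_gap_def speed_def eventually_at_filter)
  qed
  moreover have "at 0 within {0::real..} = at_right 0"
  proof -
    have "{0::real..} - {0} = {0<..} - {0}" by auto
    then show ?thesis by (simp add: at_within_def)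
  qed
  ultimately have 0: "continuous (at 0 within {0..}) speed_gap"
    by (simp add: continuous_within speed_gap_def)
  have "isCont speed_gap x" if "x > 0" for x
  proof -
    have "continuous_on {0<..} (\<lambda>w. 1 / speed w - 1 / w)"
      using speed_pos by (intro continuous_intros continuous_on_speed) force+
    then have "continuous_on {0<..} speed_gap"
      by (rule continuous_on_eq) (auto simp: speed_gap_def)
    then show ?thesis
      using that by (simp add: continuous_on_eq_continuous_at)
  qed
  then have "continuous (at x within {0..}) speed_gap" if "x \<ge> 0" for x
    using 0 that by (cases "x = 0") (auto intro: continuous_at_imp_continuous_at_within)
  then show ?thesis
    by (auto simp: continuous_on_eq_continuous_within)
qed

lemma speed_gap_nonpos: "0 \<le> w \<Longrightarrow> speed_gap w \<le> 0"
  using speed_ge[of w] by (auto simp: speed_gap_def intro!: divide_left_mono)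

lemma speed_gap_integrable: "speed_gap integrable_on {0..u}"
  by (intro integrable_continuous_interval continuous_on_subset[OF continuous_on_speed_gap]) auto

lemma DERIV_log_time: assumes "0 < u" shows "(log_time has_real_derivative 1 / speed u) (at u)"
proof -
  have "((\<lambda>x. integral {0..x} speed_gap) has_real_derivative speed_gap u) (at u within {0..u + 1})"
    using assms by (intro integral_has_real_derivative continuous_on_subset[OF
        continuous_on_speed_gap]) auto
  moreover have "at u within {0..u + 1} = at u"
    using assms by (intro at_within_interior) auto
  ultimately show ?thesis
    unfolding log_time_def using assms
    by (auto intro!: derivative_eq_intros simp: speed_gap_def)
qed

lemma isCont_log_time: "0 < u \<Longrightarrow> isCont log_time u"
  by (rule DERIV_isCont[OF DERIV_log_time])

lemma log_time_strict_mono: assumes "0 < u" "u < v" shows "log_time u < log_time v"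
proof (rule DERIV_pos_imp_increasing[OF assms(2)])
  fix x assume "u \<le> x" "x \<le> v"
  with assms(1) have "0 < x" by simp
  then show "\<exists>y. (log_time has_real_derivative y) (at x) \<and> 0 < y"
    using DERIV_log_time[of x] speed_pos[of x] by (intro exI[of _ "1 / speed x"]) simp
qed

lemma log_time_le_ln: "0 < u \<Longrightarrow> log_time u \<le> ln u"
  unfolding log_time_def using integral_le[OF speed_gap_integrable[of u] integrable_0, of]
      speed_gap_nonpos by simp

text \<open>C bounds \<open>speed_gap\<close> on [0, 1]. Together with \<open>log_time_le_ln\<close>
  this gives log_time u = ln u + O(u), the precision needed for a second-order expansion of the
  inverse function.\<close>

lemma log_time_ge_ln: "\<exists>C\<ge>0. \<forall>u. 0 < u \<longrightarrow> u \<le> 1 \<longrightarrow> ln u - C * u \<le> log_time u"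
proof -
  have "compact (speed_gap ` {0..1})"
    by (intro compact_continuous_image continuous_on_subset[OF continuous_on_speed_gap]) auto
  then obtain C where C: "\<forall>w\<in>{0..1}. norm (speed_gap w) \<le> C"
    using compact_imp_bounded bounded_iff by (metis imageI)
  have "ln u - C * u \<le> log_time u" if "0 < u" "u \<le> 1" for u
  proof -
    have "norm (integral {0..u} speed_gap) \<le> C * (u - 0)"
      using that C by (intro integral_bound continuous_on_subset[OF continuous_on_speed_gap]) auto
    then show ?thesis
      unfolding log_time_def by simp
  qed
  moreover have "0 \<le> C"
    using C[rule_format, of 0] by (simp add: speed_gap_def)
  ultimately show ?thesis by blast
qed

section \<open>The total time until blow-up\<close>

lemma set_integrable_inverse_speed: "set_integrable lborel {1..} (\<lambda>u. 1 / speed u)"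
proof -
  have "(\<integral>\<^sup>+u. ennreal (exp (- u / 2)) * indicator {1..} u \<partial>lborel)
      = ennreal (0 - (- 2 * exp (- 1 / 2)))"
  proof (rule nn_integral_FTC_atLeast)
    show "((\<lambda>u::real. - 2 * exp (- u / 2)) \<longlongrightarrow> 0) at_top"
      by real_asymp
  qed (auto intro!: derivative_eq_intros)
  moreover have "(\<integral>\<^sup>+u. ennreal (indicator {1..} u *\<^sub>R exp (- u / 2)) \<partial>lborel)
      = (\<integral>\<^sup>+u. ennreal (exp (- u / 2)) * indicator {1..} u \<partial>lborel)"
    by (intro nn_integral_cong) (simp split: split_indicator)
  ultimately have "set_integrable lborel {1..} (\<lambda>u::real. exp (- u / 2))"
    unfolding set_integrable_def by (intro integrableI_nonneg) auto
  then have "set_integrable lborel {1..} (\<lambda>u::real. 2 * exp (- u / 2))"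
    by simp
  then show ?thesis
  proof (rule set_integrable_bound)
    show "AE x in lborel. x \<in> {1..} \<longrightarrow> norm (1 / speed x) \<le> norm (2 * exp (- x / 2))"
    proof (intro AE_I2 impI)
      fix x :: real assume "x \<in> {1..}"
      then show "norm (1 / speed x) \<le> norm (2 * exp (- x / 2))"
        using inverse_speed_le[of x] speed_pos[of x] by simp
    qed
  qed (simp add: set_borel_measurable_def)
qed

text \<open>The integrand in \<open>r_star\<close> is \<open>speed_gap\<close> on (0, 1) and 1 /
  speed on [1, \<infinity>). Since ln 1 = 0, the first part is exactly \<open>log_time 1\<close>;
  the second is the remaining time to travel from level 1 to infinity.\<close>

lemma log_time_tendsto: "(log_time \<longlongrightarrow> ln r_star) at_top"
proof -
  let ?k = "\<lambda>u. 1 / sqrt (2 * (exp u - u - 1)) - (if u < 1 then 1 / u else (0::real))"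
  have cont: "continuous_on {0..1} speed_gap"
    by (rule continuous_on_subset[OF continuous_on_speed_gap]) auto
  have k1: "set_integrable lborel {0..1} speed_gap"
    by (rule borel_integrable_atLeastAtMost'[OF cont])
  have k0: "set_integrable lborel {0<..<1} speed_gap"
    by (rule set_integrable_subset[OF k1]) auto
  have eq0: "set_integrable lborel {0<..<1} ?k \<longleftrightarrow> set_integrable lborel {0<..<1} speed_gap"
    by (rule set_integrable_cong) (auto simp: speed_gap_def speed_def)
  have eq1: "set_integrable lborel {1..} ?k \<longleftrightarrow> set_integrable lborel {1..} (\<lambda>u. 1 / speed u)"
    by (rule set_integrable_cong) (auto simp: speed_def)
  have "(LINT u:{0<..}|lborel. ?k u) = (LINT u:{0<..<1} \<union> {1..}|lborel. ?k u)"
    by (rule arg_cong[where f="\<lambda>A. LINT u:A|lborel. ?k u"]) auto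
  also have "\<dots> = (LINT u:{0<..<1}|lborel. ?k u) + (LINT u:{1..}|lborel. ?k u)"
    by (intro set_integral_Un) (use eq0 eq1 k0 set_integrable_inverse_speed in auto)
  also have "(LINT u:{0<..<1}|lborel. ?k u) = (LINT u:{0<..<1}|lborel. speed_gap u)"
    by (rule set_lebesgue_integral_cong) (auto simp: speed_gap_def speed_def)
  also have "\<dots> = integral {0<..<1} speed_gap"
    by (rule set_borel_integral_eq_integral[OF k0])
  also have "\<dots> = integral {0..1} speed_gap"
    by (rule integral_open_interval_real[symmetric])
  also have "\<dots> = log_time 1"
    by (simp add: log_time_def)
  also have "(LINT u:{1..}|lborel. ?k u) = (LINT u:{1..}|lborel. 1 / speed u)"
    by (rule set_lebesgue_integral_cong) (auto simp: speed_def)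
  finally have r: "ln r_star = log_time 1 + (LINT u:{1..}|lborel. 1 / speed u)"
    by (simp add: r_star_def)
  have "((\<lambda>b. log_time 1 + (LINT u:{1..b}|lborel. 1 / speed u)) \<longlongrightarrow> ln r_star) at_top"
    unfolding r by (intro tendsto_intros tendsto_set_lebesgue_integral_at_top
        set_integrable_inverse_speed) auto
  then show ?thesis
  proof (rule Lim_transform_eventually)
    show "\<forall>\<^sub>F b in at_top. log_time 1 + (LINT u:{1..b}|lborel. 1 / speed u) = log_time b"
      using eventually_ge_at_top[of 1]
    proof eventually_elim
      case (elim b)
      have "(LINT u:{1..b}|lborel. 1 / speed u) = integral {1..b} (\<lambda>u. 1 / speed u)"
        by (rule set_borel_integral_eq_integral[OF set_integrable_subset[OF
            set_integrable_inverse_speed]]) auto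
      also have "((\<lambda>u. 1 / speed u) has_integral (log_time b - log_time 1)) {1..b}"
        using elim
        by (intro fundamental_theorem_of_calculus)
          (auto simp flip: has_real_derivative_iff_has_vector_derivative intro: DERIV_subset[OF
              DERIV_log_time])
      then have "integral {1..b} (\<lambda>u. 1 / speed u) = log_time b - log_time 1"
        by (rule integral_unique)
      finally show ?case by simp
    qed
  qed
qed

lemma log_time_less: assumes "0 < u" shows "log_time u < ln r_star"
proof -
  \<comment> \<open>The limit gives only a weak inequality; evaluating at u + 1 leaves room for
    strictness at u.\<close>
  have "log_time (u + 1) \<le> ln r_star"
  proof (rule tendsto_lowerbound[OF log_time_tendsto])
    show "\<forall>\<^sub>F v in at_top. log_time (u + 1) \<le> log_time v"
      using eventually_gt_at_top[of "u + 1"]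
          by eventually_elim (use assms log_time_strict_mono in \<open>auto intro: less_imp_le\<close>)
  qed simp
  with log_time_strict_mono[of u "u + 1"] assms show ?thesis by simp
qed

lemma r_star_pos: "0 < r_star"
  by (simp add: r_star_def)

lemma log_time_surj: assumes "t < ln r_star" shows "\<exists>u>0. log_time u = t"
proof -
  obtain b where b: "1 \<le> b" "t < log_time b"
    using eventually_happens[OF eventually_conj[OF eventually_ge_at_top[of 1] order_tendstoD(1)[OF
        log_time_tendsto assms]]]
    by auto
  \<comment> \<open>The bound \<open>log_time a \<le> ln a\<close> puts a at or before time t; the
    minimum with 1 ensures a \<le> b.\<close>
  define a where "a = min 1 (exp t)"
  have a: "0 < a" "a \<le> b" using b by (auto simp: a_def)
  have "log_time a \<le> ln a" by (rule log_time_le_ln[OF a(1)])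
  also have "\<dots> \<le> t"
    using a(1) ln_le_cancel_iff[of a "exp t"] by (simp add: a_def)
  finally have "log_time a \<le> t" .
  then have "\<exists>x\<ge>a. x \<le> b \<and> log_time x = t"
    using a b isCont_log_time by (intro IVT) auto
  then obtain x where "a \<le> x" "log_time x = t" by blast
  then show ?thesis using a by (intro exI[of _ x]) auto
qed

text \<open>The solution of the differential equation;
  0 is a junk value beyond the blow-up time \<open>ln r_star\<close>.\<close>

definition cumulant :: "real \<Rightarrow> real" where
  "cumulant t = (if t < ln r_star then THE u. 0 < u \<and> log_time u = t else 0)"

lemma cumulant_log_time [simp]: assumes "0 < u" shows "cumulant (log_time u) = u"
proof -
  have "(THE v. 0 < v \<and> log_time v = log_time u) = u"
  proof (rule the_equality)
    fix v assume "0 < v \<and> log_time v = log_time u"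
    then show "v = u"
      using log_time_strict_mono[of u v] log_time_strict_mono[of v u] assms
          by (cases u v rule: linorder_cases) auto
  qed (use assms in auto)
  then show ?thesis
    using log_time_less[OF assms] by (simp add: cumulant_def)
qed

lemma cumulant: assumes "t < ln r_star"
    shows cumulant_pos: "0 < cumulant t" and log_time_cumulant: "log_time (cumulant t) = t"
  using log_time_surj[OF assms] cumulant_log_time by auto

lemma cumulant_nonneg: "0 \<le> cumulant t"
  using cumulant_pos[of t] by (cases "t < ln r_star") (auto simp: cumulant_def)

lemma cumulant_strict_mono: assumes "s < t" "t < ln r_star" shows "cumulant s < cumulant t"
proof (rule ccontr)
  assume "\<not> cumulant s < cumulant t"
  then have "log_time (cumulant t) \<le> log_time (cumulant s)"
    using log_time_strict_mono[of "cumulant t" "cumulant s"] cumulant_pos[of t] assms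
        by (cases "cumulant s = cumulant t") auto
  then show False using assms log_time_cumulant by simp
qed

lemma cumulant_mono: "s \<le> t \<Longrightarrow> t < ln r_star \<Longrightarrow> cumulant s \<le> cumulant t"
  using cumulant_strict_mono[of s t] by (cases "s = t") auto

section \<open>Regularity and growth of the solution\<close>

lemma isCont_cumulant: assumes "t < ln r_star" shows "isCont cumulant t"
proof -
  define u where "u = cumulant t"
  have u: "0 < u" "log_time u = t" using cumulant[OF assms] by (auto simp: u_def)
  have "isCont cumulant (log_time u)"
    by (rule isCont_inverse_function[where d="u / 2"]) (use u in \<open>auto simp: abs_if field_simps
        split: if_splits intro!: cumulant_log_time isCont_log_time\<close>)
  then show ?thesis using u by simp
qed

lemma DERIV_cumulant: assumes "t < ln r_star"
    shows "(cumulant has_real_derivative speed (cumulant t)) (at t)"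
proof -
  have "(cumulant has_real_derivative inverse (1 / speed (cumulant t))) (at t)"
  proof (rule DERIV_inverse_function)
    show "(log_time has_real_derivative 1 / speed (cumulant t)) (at (cumulant t))"
      by (rule DERIV_log_time[OF cumulant_pos[OF assms]])
    show "t - 1 < t" "t < ln r_star" using assms by auto
  qed (use speed_pos[OF cumulant_pos[OF assms]] log_time_cumulant isCont_cumulant[OF assms] in auto)
  then show ?thesis by simp
qed

lemma borel_measurable_cumulant [measurable]: "cumulant \<in> borel_measurable borel"
proof -
  have "continuous_on {..<ln r_star} cumulant"
    using isCont_cumulant by (intro continuous_at_imp_continuous_on) auto
  then have "(\<lambda>t. if t \<in> {..<ln r_star} then cumulant t else 0) \<in> borel_measurable borel"
    by (intro borel_measurable_continuous_on_if) auto
  also have "(\<lambda>t. if t \<in> {..<ln r_star} then cumulant t else 0) = cumulant"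
    by (auto simp: cumulant_def)
  finally show ?thesis .
qed

lemma exp_le_cumulant: assumes "t < ln r_star" shows "exp t \<le> cumulant t"
proof -
  have "t \<le> ln (cumulant t)"
    using log_time_le_ln[OF cumulant_pos[OF assms]] log_time_cumulant[OF assms] by simp
  then show ?thesis using cumulant_pos[OF assms] by (simp add: ln_ge_iff)
qed

text \<open>With u = \<open>cumulant t\<close>, the bound ln u - C u \<le> t and u \<le> 1 give the
  crude estimate u \<le> e^C e^t. It is inserted into the quadratic error of u \<le> e^t + C u^2; D
  is the larger of the two constants that result.\<close>

lemma cumulant_upper: "\<exists>D\<ge>0. \<forall>t. t < ln r_star \<longrightarrow> cumulant t \<le> 1 \<longrightarrow> cumulant t \<le> exp t + D * exp (2 *
    t) \<and> cumulant t \<le> D * exp t"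
proof -
  obtain C where C: "0 \<le> C" "\<And>u. 0 < u \<Longrightarrow> u \<le> 1 \<Longrightarrow> ln u - C * u \<le> log_time u"
    using log_time_ge_ln by blast
  define D where "D = max (C * exp C ^ 2) (exp C)"
  have "cumulant t \<le> exp t + D * exp (2 * t) \<and> cumulant t \<le> D * exp t" if t: "t < ln r_star"
      "cumulant t \<le> 1" for t
  proof -
    define u where "u = cumulant t"
    have u: "0 < u" "u \<le> 1" "log_time u = t" using cumulant[OF t(1)] t by (auto simp: u_def)
    have "ln u - C * u \<le> t" using C(2)[of u] u by simp
    then have "exp (ln u - C * u) \<le> exp t" by simp
    then have *: "u * exp (- C * u) \<le> exp t" using u by (simp add: exp_diff exp_minus field_simps)
    have "exp (- C) \<le> exp (- C * u)" using u C by (simp add: mult_left_le)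
    then have "u * exp (- C) \<le> u * exp (- C * u)" using u by simp
    with * have "u * exp (- C) \<le> exp t" by simp
    then have u_le: "u \<le> exp C * exp t" by (simp add: exp_minus field_simps)
    have "u * (1 - C * u) \<le> u * exp (- C * u)"
      using u exp_ge_add_one_self[of "- C * u"] by (intro mult_left_mono) auto
    then have "u \<le> exp t + C * u\<^sup>2" using * by (simp add: algebra_simps power2_eq_square)
    also have "C * u\<^sup>2 \<le> C * (exp C * exp t)\<^sup>2"
      using u_le u C by (intro mult_left_mono power_mono) auto
    also have "\<dots> = (C * exp C ^ 2) * exp (2 * t)"
      by (simp add: power_mult_distrib exp_double)
    also have "\<dots> \<le> D * exp (2 * t)" by (simp add: D_def)
    finally have "u \<le> exp t + D * exp (2 * t)" by simp
    moreover have "u \<le> D * exp t" using u_le by (rule order_trans) (simp add: D_def)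
    ultimately show ?thesis by (simp add: u_def)
  qed
  moreover have "0 \<le> D" by (simp add: D_def le_max_iff_disj)
  ultimately show ?thesis by blast
qed

lemma cumulant_at_bot: "(cumulant \<longlongrightarrow> 0) at_bot"
proof -
  obtain D where D: "\<And>t. t < ln r_star \<Longrightarrow> cumulant t \<le> 1 \<Longrightarrow> cumulant t \<le> D * exp t"
    using cumulant_upper by blast
  have "cumulant t \<le> D * exp t" if "t \<le> log_time 1" for t
  proof (rule D)
    show t: "t < ln r_star" using that log_time_less[of 1] by simp
    show "cumulant t \<le> 1" using cumulant_mono[OF that log_time_less] by simp
  qed
  then have "eventually (\<lambda>t. cumulant t \<le> D * exp t) at_bot"
    by (rule eventually_mono[OF eventually_le_at_bot])
  moreover have "((\<lambda>t. D * exp t) \<longlongrightarrow> 0) at_bot"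
    using tendsto_mult_right_zero[OF exp_at_bot] by blast
  ultimately show ?thesis
    using cumulant_nonneg by (intro tendsto_sandwich[of "\<lambda>_. 0" cumulant at_bot "\<lambda>t. D * exp t"])
        auto
qed

lemma cumulant_diff_at_top: "((\<lambda>x. cumulant (t - x)) \<longlongrightarrow> 0) at_top"
proof -
  have "filterlim (\<lambda>x::real. t - x) at_bot at_top"
    by real_asymp
  from filterlim_compose[OF cumulant_at_bot this] show ?thesis .
qed

text \<open>Both integrands are derivatives along the solution:
  \<open>speed(h)' = e^h - 1\<close> and \<open>h' = speed(h)\<close>.\<close>

lemma nn_integral_speed_cumulant:
  assumes t: "t < ln r_star"
  shows "(\<integral>\<^sup>+x\<in>{0..}. (\<integral>\<^sup>+y\<in>{0..}. em1 (ennreal (cumulant (t - (x + y)))) \<partial>lborel) \<partial>lborel)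
      = ennreal (cumulant t)"
proof -
  have inner: "(\<integral>\<^sup>+y\<in>{0..}. em1 (ennreal (cumulant (t - (x + y)))) \<partial>lborel)
      = ennreal (speed (cumulant (t - x)))" if "0 \<le> x" for x
  proof -
    have "(\<integral>\<^sup>+y. ennreal (exp (cumulant (t - (x + y))) - 1) * indicator {0..} y \<partial>lborel)
        = ennreal (0 - (- speed (cumulant (t - (x + 0)))))"
    proof (rule nn_integral_FTC_atLeast)
      fix y :: real assume y: "0 \<le> y"
      then have ty: "t - (x + y) < ln r_star" using that t by simp
      then have pos: "0 < cumulant (t - (x + y))" by (rule cumulant_pos)
      have *: "((\<lambda>y. speed (cumulant (t - (x + y)))) has_real_derivative (exp (cumulant (t - (x +
          y))) - 1) / speed (cumulant (t - (x + y))) * (speed (cumulant (t - (x + y))) * (- 1)))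
          (at y)"
        by (rule DERIV_chain2[where f=speed, OF DERIV_speed[OF pos] DERIV_chain2[where f=cumulant
            and g="\<lambda>y. t - (x + y)", OF DERIV_cumulant[OF ty]]])
          (auto intro!: derivative_eq_intros)
      show "((\<lambda>y. - speed (cumulant (t - (x + y)))) has_real_derivative exp (cumulant (t - (x +
          y))) - 1) (at y)"
        using DERIV_minus[OF *] speed_pos[OF pos] by simp
    next
      have "((\<lambda>y. speed (cumulant (t - x - y))) \<longlongrightarrow> speed 0) at_top"
        using continuous_on_speed[of UNIV]
            by (intro isCont_tendsto_compose[OF _ cumulant_diff_at_top]) (auto simp:
            continuous_on_eq_continuous_at)
      then show "((\<lambda>y. - speed (cumulant (t - (x + y)))) \<longlongrightarrow> 0) at_top"
        using tendsto_minus by (fastforce simp: algebra_simps)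
    qed (auto simp: cumulant_nonneg)
    then show ?thesis by (simp add: cumulant_nonneg)
  qed
  have "(\<integral>\<^sup>+x\<in>{0..}. (\<integral>\<^sup>+y\<in>{0..}. em1 (ennreal (cumulant (t - (x + y)))) \<partial>lborel) \<partial>lborel)
      = (\<integral>\<^sup>+x\<in>{0..}. ennreal (speed (cumulant (t - x))) \<partial>lborel)"
    by (intro nn_integral_cong) (simp add: inner split: split_indicator)
  also have "\<dots> = ennreal (0 - (- cumulant (t - 0)))"
  proof (rule nn_integral_FTC_atLeast)
    fix x :: real assume "0 \<le> x"
    then have "t - x < ln r_star" using t by simp
    have "((\<lambda>x. cumulant (t - x)) has_real_derivative speed (cumulant (t - x)) * (- 1)) (at x)"
      by (rule DERIV_chain2[where f=cumulant and g="\<lambda>x. t - x", OF DERIV_cumulant[OF \<open>t - x < ln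
          r_star\<close>]])
        (auto intro!: derivative_eq_intros)
    from DERIV_minus[OF this]
    show "((\<lambda>x. - cumulant (t - x)) has_real_derivative speed (cumulant (t - x))) (at x)"
      by simp
    show "0 \<le> speed (cumulant (t - x))"
        by (rule order_trans[OF cumulant_nonneg speed_ge[OF cumulant_nonneg]])
  next
    show "((\<lambda>x. - cumulant (t - x)) \<longlongrightarrow> 0) at_top"
      using tendsto_minus[OF cumulant_diff_at_top] by simp
  qed measurable
  finally show ?thesis by simp
qed

text \<open>Exponentials are eigenfunctions of the linearized operator. The eigenvalue 1 at k = 1
  reflects the constant mean of W_n; the eigenvalues below 1 at k > 1 make contraction
  possible.\<close>

lemma nn_integral_exp_iterated:
  assumes k: "0 < (k::real)"
  shows "(\<integral>\<^sup>+x\<in>{0..}. (\<integral>\<^sup>+y\<in>{0..}. ennreal (exp (k * (t - (x + y)))) \<partial>lborel) \<partial>lborel)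
      = ennreal (exp (k * t) / k\<^sup>2)"
proof -
  have *: "(\<integral>\<^sup>+y\<in>{0..}. ennreal (c * exp (- k * y)) \<partial>lborel)
      = ennreal (c / k)" if "0 \<le> c" for c :: real
  proof -
    have "(\<integral>\<^sup>+y. ennreal (c * exp (- k * y)) * indicator {0..} y \<partial>lborel)
        = ennreal (0 - (- c / k * exp (- k * 0)))"
    proof (rule nn_integral_FTC_atLeast)
      show "((\<lambda>y. - c / k * exp (- k * y)) \<longlongrightarrow> 0) at_top"
        using k by real_asymp
    qed (use k that in \<open>auto intro!: derivative_eq_intros\<close>)
    then show ?thesis by simp
  qed
  have "(\<integral>\<^sup>+y\<in>{0..}. ennreal (exp (k * (t - (x + y)))) \<partial>lborel)
      = ennreal (exp (k * t) / k * exp (- k * x))" for x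
    using *[of "exp (k * t) * exp (- k * x)"] by (simp add: algebra_simps flip: exp_add)
  then show ?thesis
    using *[of "exp (k * t) / k"] k by (simp add: power2_eq_square)
qed

text \<open>As h = \<open>cumulant (ln s)\<close> tends to infinity, speed h ~ sqrt 2 e^(h/2), so
  the s-derivative of e^(-h/2) tends to -(sqrt 2 / 2) / r*, the factor 1 / r* being the derivative
  of ln. L'Hopital's rule turns this into linear vanishing of e^(-h/2); the claim is the reciprocal
  square.\<close>

lemma cumulant_blowup: "((\<lambda>s. (r_star - s)\<^sup>2 * exp (cumulant (ln s))) \<longlongrightarrow> 2 * r_star\<^sup>2) (at_left
    r_star)"
proof -
  have ev: "eventually (\<lambda>s. s \<in> {0<..<r_star}) (at_left r_star)"
    using r_star_pos by (rule eventually_at_left_real)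
  have ln_less: "ln s < ln r_star" if "s \<in> {0<..<r_star}" for s
    using that by simp
  have H_top: "filterlim (\<lambda>s. cumulant (ln s)) at_top (at_left r_star)"
    unfolding filterlim_at_top_dense
  proof
    fix Z :: real
    define u where "u = max Z 1"
    have "exp (log_time u) < r_star"
      using log_time_less[of u] r_star_pos by (simp add: u_def flip: ln_less_cancel_iff)
    then have "eventually (\<lambda>s. s \<in> {exp (log_time u)<..<r_star}) (at_left r_star)"
      by (rule eventually_at_left_real)
    then show "eventually (\<lambda>s. Z < cumulant (ln s)) (at_left r_star)"
    proof eventually_elim
      case (elim s)
      then have "0 < s" using exp_gt_zero[of "log_time u"] by (auto simp del: exp_gt_zero)
      then have "log_time u < ln s" "ln s < ln r_star"
        using elim ln_less_cancel_iff[of "exp (log_time u)" s] by auto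
      then show ?case
        using cumulant_strict_mono[of "log_time u" "ln s"] by (auto simp: u_def)
    qed
  qed
  have lim: "((\<lambda>s. exp (- cumulant (ln s) / 2) / (r_star - s)) \<longlongrightarrow> (sqrt 2 / 2) / r_star) (at_left
      r_star)"
  proof (rule lhopital_left)
    have "((\<lambda>u::real. exp (- u / 2)) \<longlongrightarrow> 0) at_top" by real_asymp
    from filterlim_compose[OF this H_top] show "((\<lambda>s. exp (- cumulant (ln s) / 2)) \<longlongrightarrow> 0) (at_left
        r_star)" .
    show "((\<lambda>s. r_star - s) \<longlongrightarrow> 0) (at_left r_star)"
      by (auto intro!: tendsto_eq_intros)
    show "\<forall>\<^sub>F s in at_left r_star. r_star - s \<noteq> 0"
      using ev by eventually_elim auto
    show "\<forall>\<^sub>F s in at_left r_star. (- 1 :: real) \<noteq> 0" by simp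
    show "\<forall>\<^sub>F s in at_left r_star. ((\<lambda>s. exp (- cumulant (ln s) / 2)) has_real_derivative
        - (exp (- cumulant (ln s) / 2) * speed (cumulant (ln s)) / 2) / s) (at s)"
      using ev
    proof eventually_elim
      case (elim s)
      have "((\<lambda>s. cumulant (ln s)) has_real_derivative speed (cumulant (ln s)) * (1 / s)) (at s)"
        by (rule DERIV_chain2[where f=cumulant and g=ln, OF DERIV_cumulant[OF ln_less[OF elim]]])
            (use elim in \<open>auto intro!: derivative_eq_intros\<close>)
      then show ?case
        by (auto intro!: derivative_eq_intros)
    qed
    show "\<forall>\<^sub>F s in at_left r_star. ((\<lambda>s. r_star - s) has_real_derivative - 1) (at s)"
      by (auto intro!: derivative_eq_intros always_eventually)
    have "((\<lambda>u::real. exp (- u / 2) * speed u / 2) \<longlongrightarrow> 2 powr (1 / 2) / 2) at_top"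
      unfolding speed_def by real_asymp
    then have Q_lim: "((\<lambda>u::real. exp (- u / 2) * speed u / 2) \<longlongrightarrow> sqrt 2 / 2) at_top"
      by (simp add: powr_half_sqrt)
    then have "((\<lambda>s. (exp (- cumulant (ln s) / 2) * speed (cumulant (ln s)) / 2) / s) \<longlongrightarrow> (sqrt 2 /
        2) / r_star) (at_left r_star)"
      using r_star_pos by (intro tendsto_divide filterlim_compose[OF Q_lim H_top] tendsto_ident_at)
          auto
    then show "((\<lambda>s. - (exp (- cumulant (ln s) / 2) * speed (cumulant (ln s)) / 2) / s / - 1) \<longlongrightarrow>
        (sqrt 2 / 2) / r_star) (at_left r_star)"
      by simp
  qed
  have "((\<lambda>s. 1 / (exp (- cumulant (ln s) / 2) / (r_star - s))\<^sup>2) \<longlongrightarrow> 1 / ((sqrt 2 / 2) / r_star)\<^sup>2)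
      (at_left r_star)"
    using r_star_pos by (intro tendsto_divide tendsto_const tendsto_power lim) auto
  moreover have "1 / ((sqrt 2 / 2) / r_star)\<^sup>2 = 2 * r_star\<^sup>2"
    by (simp add: power_divide field_simps)
  moreover have "1 / (exp (- cumulant (ln s) / 2) / (r_star - s))\<^sup>2
      = (r_star - s)\<^sup>2 * exp (cumulant (ln s))" for s
  proof -
    have sq: "(exp (- cumulant (ln s) / 2))\<^sup>2 = exp (- cumulant (ln s))"
      by (simp flip: exp_double)
    have "1 / (exp (- cumulant (ln s) / 2) / (r_star - s))\<^sup>2
        = (r_star - s)\<^sup>2 / exp (- cumulant (ln s))"
      unfolding power_divide sq by simp
    also have "\<dots> = (r_star - s)\<^sup>2 * exp (cumulant (ln s))"
      unfolding exp_minus divide_inverse by simp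
    finally show ?thesis .
  qed
  ultimately show ?thesis by simp
qed

section \<open>The fixed-point equation\<close>

text \<open>Iterated integrals over closed half-lines fit the fundamental theorem of calculus; the
  axes of the quadrant are null sets, as used in \<open>nn_integral_quadrant\<close>.\<close>

definition iterate_exp :: "(real \<Rightarrow> ennreal) \<Rightarrow> real \<Rightarrow> ennreal" where
  "iterate_exp g t = (\<integral>\<^sup>+x\<in>{0..}. (\<integral>\<^sup>+y\<in>{0..}. em1 (g (t - (x + y))) \<partial>lborel) \<partial>lborel)"

text \<open>\<open>logmgf n t\<close> will be the logarithm of the expectation of \<open>exp (e^t W_n)\<close>.\<close>

fun logmgf :: "nat \<Rightarrow> real \<Rightarrow> ennreal" where
  "logmgf 0 t = ennreal (exp t)"
| "logmgf (Suc n) t = iterate_exp (logmgf n) t"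

lemma iterate_exp_measurable:
  assumes [measurable]: "g \<in> borel_measurable borel"
  shows "iterate_exp g \<in> borel_measurable borel"
  unfolding iterate_exp_def by measurable

lemma logmgf_measurable [measurable]: "logmgf n \<in> borel_measurable borel"
proof (induction n)
  case (Suc n)
  have "logmgf (Suc n) = iterate_exp (logmgf n)"
    by (auto simp: fun_eq_iff)
  then show ?case
    using iterate_exp_measurable[OF Suc] by simp
qed (simp add: measurable_def[symmetric] cong: measurable_cong)

text \<open>The operator only looks at times up to t. This is why estimates valid below
  \<open>ln r_star\<close> can be iterated there, whatever happens beyond.\<close>

lemma iterate_exp_mono:
  assumes "\<And>s. s \<le> t \<Longrightarrow> f s \<le> g s"
  shows "iterate_exp f t \<le> iterate_exp g t"
  unfolding iterate_exp_def
  by (intro nn_integral_mono) (auto simp: indicator_def intro!: nn_integral_mono em1_mono assms)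

lemma iterate_exp_cumulant: "t < ln r_star \<Longrightarrow> iterate_exp (\<lambda>s. ennreal (cumulant s)) t
    = ennreal (cumulant t)"
  unfolding iterate_exp_def by (rule nn_integral_speed_cumulant)

text \<open>The start e^t is fixed by the linearized operator, and em1 w \<ge> w; monotonicity does
  the rest. It is the analytic form of the submartingale property of exp (e^t W_n).\<close>

lemma logmgf_le_Suc: "logmgf n t \<le> logmgf (Suc n) t"
proof (induction n arbitrary: t)
  case 0
  have "ennreal (exp t) = (\<integral>\<^sup>+x\<in>{0..}. (\<integral>\<^sup>+y\<in>{0..}. ennreal (exp (t - (x + y))) \<partial>lborel) \<partial>lborel)"
    using nn_integral_exp_iterated[of 1 t] by simp
  also have "\<dots> \<le> iterate_exp (logmgf 0) t"
    unfolding iterate_exp_def logmgf.simps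
    by (intro nn_integral_mono mult_right_mono le_em1) auto
  finally show ?case by simp
next
  case (Suc n)
  then show ?case by (auto intro: iterate_exp_mono)
qed

lemma incseq_logmgf: "incseq (\<lambda>n. logmgf n t)"
  by (rule incseq_SucI) (rule logmgf_le_Suc)

text \<open>Comparison principle: \<open>cumulant\<close> is a fixed point above the starting
  function. In particular the exponential moments are finite below \<open>r_star\<close>, uniformly
  in n.\<close>

lemma logmgf_le_cumulant: "t < ln r_star \<Longrightarrow> logmgf n t \<le> ennreal (cumulant t)"
proof (induction n arbitrary: t)
  case 0
  then show ?case using exp_le_cumulant by (auto intro: ennreal_leI)
next
  case (Suc n)
  have "logmgf (Suc n) t \<le> iterate_exp (\<lambda>s. ennreal (cumulant s)) t"
    unfolding logmgf.simps using Suc by (intro iterate_exp_mono) auto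
  then show ?case using iterate_exp_cumulant[OF Suc.prems] by simp
qed

lemma iterate_exp_SUP:
  assumes inc: "\<And>t. incseq (\<lambda>n. g n t)" and [measurable]: "\<And>n. g n \<in> borel_measurable borel"
  shows "iterate_exp (\<lambda>t. SUP n. g n t) t = (SUP n. iterate_exp (g n) t)"
proof -
  have le: "g m s \<le> g n s" if "m \<le> n" for m n s
    using inc[of s] that by (auto simp: incseq_def)
  have "(\<integral>\<^sup>+y\<in>{0..}. em1 (SUP n. g n (t - (x + y))) \<partial>lborel)
      = (SUP n. \<integral>\<^sup>+y\<in>{0..}. em1 (g n (t - (x + y))) \<partial>lborel)" for x
  proof -
    have "(\<integral>\<^sup>+y\<in>{0..}. em1 (SUP n. g n (t - (x + y))) \<partial>lborel)
        = (\<integral>\<^sup>+y. (SUP n. em1 (g n (t - (x + y))) * indicator {0..} y) \<partial>lborel)"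
      by (intro nn_integral_cong) (simp add: em1_SUP[OF inc] SUP_mult_right_ennreal)
    also have "\<dots> = (SUP n. \<integral>\<^sup>+y\<in>{0..}. em1 (g n (t - (x + y))) \<partial>lborel)"
      by (intro nn_integral_monotone_convergence_SUP)
        (auto simp: incseq_def intro!: le_funI mult_right_mono em1_mono le)
    finally show ?thesis .
  qed
  then have "iterate_exp (\<lambda>t. SUP n. g n t) t
      = (\<integral>\<^sup>+x. (SUP n. (\<integral>\<^sup>+y\<in>{0..}. em1 (g n (t - (x + y))) \<partial>lborel) * indicator {0..} x) \<partial>lborel)"
    unfolding iterate_exp_def by (intro nn_integral_cong) (simp add: SUP_mult_right_ennreal)
  also have "\<dots> = (SUP n. iterate_exp (g n) t)"
    unfolding iterate_exp_def
    by (intro nn_integral_monotone_convergence_SUP)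
      (auto simp: incseq_def intro!: le_funI mult_right_mono nn_integral_mono em1_mono le)
  finally show ?thesis .
qed

text \<open>The least solution above e^t. Below \<open>ln r_star\<close> the supremum is finite, so
  nothing is lost by \<open>enn2real\<close>; elsewhere the value may be the default 0.\<close>

definition sup_logmgf :: "real \<Rightarrow> real" where
  "sup_logmgf t = enn2real (SUP n. logmgf n t)"

lemma sup_logmgf_measurable [measurable]: "sup_logmgf \<in> borel_measurable borel"
  unfolding sup_logmgf_def by measurable

lemma ennreal_sup_logmgf:
  assumes "t < ln r_star"
  shows "ennreal (sup_logmgf t) = (SUP n. logmgf n t)"
proof -
  have "(SUP n. logmgf n t) \<le> ennreal (cumulant t)"
    using logmgf_le_cumulant[OF assms] by (intro SUP_least)
  then have "(SUP n. logmgf n t) < \<top>"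
    by (simp add: le_less_trans less_top)
  then show ?thesis
    by (simp add: sup_logmgf_def)
qed

lemma sup_logmgf_bounds:
  assumes "t < ln r_star"
  shows sup_logmgf_le_cumulant: "sup_logmgf t \<le> cumulant t"
    and exp_le_sup_logmgf: "exp t \<le> sup_logmgf t"
proof -
  have "ennreal (sup_logmgf t) \<le> ennreal (cumulant t)"
    unfolding ennreal_sup_logmgf[OF assms] using logmgf_le_cumulant[OF assms] by (intro SUP_least)
  then show "sup_logmgf t \<le> cumulant t"
    using cumulant_nonneg by simp
  have "ennreal (exp t) \<le> ennreal (sup_logmgf t)"
    unfolding ennreal_sup_logmgf[OF assms] by (rule SUP_upper2[of 0]) auto
  then show "exp t \<le> sup_logmgf t"
    by (simp add: sup_logmgf_def)
qed

lemma sup_logmgf_nonneg: "0 \<le> sup_logmgf t"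
  by (simp add: sup_logmgf_def)

lemma iterate_exp_sup_logmgf:
  assumes "t < ln r_star"
  shows "iterate_exp (\<lambda>s. ennreal (sup_logmgf s)) t = ennreal (sup_logmgf t)"
proof -
  have "iterate_exp (\<lambda>s. ennreal (sup_logmgf s)) t = iterate_exp (\<lambda>s. SUP n. logmgf n s) t"
    using assms by (intro antisym iterate_exp_mono) (auto simp: ennreal_sup_logmgf)
  also have "\<dots> = (SUP n. logmgf (Suc n) t)"
    by (simp add: iterate_exp_SUP incseq_logmgf)
  also have "\<dots> = (SUP n. logmgf n t)"
  proof (rule antisym)
    show "(SUP n. logmgf (Suc n) t) \<le> (SUP n. logmgf n t)"
      by (rule SUP_mono) blast
    show "(SUP n. logmgf n t) \<le> (SUP n. logmgf (Suc n) t)"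
      by (rule SUP_mono) (use logmgf_le_Suc in blast)
  qed
  finally show ?thesis
    using ennreal_sup_logmgf[OF assms] by simp
qed

section \<open>Equality of the two solutions by contraction\<close>

lemma exp_diff_le: "v \<le> u \<Longrightarrow> exp u - 1 \<le> (exp v - 1) + exp u * (u - v)" for u v :: real
proof -
  assume "v \<le> u"
  \<comment> \<open>By convexity the tangent of exp at u lies below the graph at v.\<close>
  have "exp u * (1 + (v - u)) \<le> exp u * exp (v - u)"
    by (intro mult_left_mono exp_ge_add_one_self) auto
  also have "\<dots> = exp v" by (simp flip: exp_add)
  finally show ?thesis by (simp add: algebra_simps)
qed

text \<open>On values up to \<open>cumulant a\<close> the function e^h - 1 has slope at most
  \<open>exp (cumulant a)\<close>, and the operator divides the weight exp (k t) by k^2; the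
  quotient is the contraction factor.\<close>

lemma gap_contraction:
  assumes k: "0 < k" and D: "0 \<le> D" and a: "a < ln r_star"
    and bound: "\<And>t. t \<le> a \<Longrightarrow> cumulant t - sup_logmgf t \<le> D * exp (k * t)"
    and t: "t \<le> a"
  shows "cumulant t - sup_logmgf t \<le> (exp (cumulant a) / k\<^sup>2 * D) * exp (k * t)"
proof -
  have ta: "t < ln r_star" using t a by simp
  define c where "c = exp (cumulant a) * D"
  have c: "0 \<le> c" using D by (simp add: c_def)
  have *: "em1 (ennreal (cumulant s)) \<le> em1 (ennreal (sup_logmgf s)) + ennreal c * ennreal (exp (k
      * s))" if "s \<le> a" for s
  proof -
    have s: "s < ln r_star" using that a by simp
    have "exp (cumulant s) - 1 \<le> (exp (sup_logmgf s) - 1) + exp (cumulant s) * (cumulant s -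
        sup_logmgf s)"
      by (rule exp_diff_le[OF sup_logmgf_le_cumulant[OF s]])
    also have "exp (cumulant s) * (cumulant s - sup_logmgf s) \<le> exp (cumulant a) * (D * exp (k *
        s))"
      using sup_logmgf_le_cumulant[OF s] bound[OF that] cumulant_mono[OF that a]
          by (intro mult_mono) auto
    finally have "exp (cumulant s) - 1 \<le> (exp (sup_logmgf s) - 1) + c * exp (k * s)"
      by (simp add: c_def mult.assoc)
    then show ?thesis
      using c by (simp add: cumulant_nonneg sup_logmgf_nonneg flip: ennreal_mult ennreal_plus)
  qed
  \<comment> \<open>In \<open>ennreal\<close> the gap is not subtracted but carried as an extra
    summand on the larger side; the difference is formed only after returning to the reals.\<close>
  have "ennreal (cumulant t) = iterate_exp (\<lambda>s. ennreal (cumulant s)) t"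
    by (rule iterate_exp_cumulant[OF ta, symmetric])
  also have "\<dots> \<le> (\<integral>\<^sup>+x\<in>{0..}. (\<integral>\<^sup>+y\<in>{0..}. (em1 (ennreal (sup_logmgf (t - (x + y)))) + ennreal c *
      ennreal (exp (k * (t - (x + y))))) \<partial>lborel) \<partial>lborel)"
    unfolding iterate_exp_def using t
    by (intro nn_integral_mono) (auto simp: indicator_def simp del: em1_ennreal intro!:
        nn_integral_mono *)
  also have "\<dots> = (\<integral>\<^sup>+x\<in>{0..}. ((\<integral>\<^sup>+y\<in>{0..}. em1 (ennreal (sup_logmgf (t - (x + y)))) \<partial>lborel) +
      ennreal c * (\<integral>\<^sup>+y\<in>{0..}. ennreal (exp (k * (t - (x + y)))) \<partial>lborel)) \<partial>lborel)"
    by (simp add: nn_integral_add nn_integral_cmult distrib_right mult.assoc del: em1_ennreal)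
  also have "\<dots> = iterate_exp (\<lambda>s. ennreal (sup_logmgf s)) t + ennreal c * ennreal (exp (k * t) /
      k\<^sup>2)"
    unfolding iterate_exp_def nn_integral_exp_iterated[OF k, symmetric]
    by (simp add: nn_integral_add nn_integral_cmult distrib_right mult.assoc del: em1_ennreal)
  also have "\<dots> = ennreal (sup_logmgf t + c * (exp (k * t) / k\<^sup>2))"
    using c by (simp add: iterate_exp_sup_logmgf[OF ta] sup_logmgf_nonneg flip: ennreal_mult
        ennreal_plus)
  finally have "cumulant t \<le> sup_logmgf t + c * (exp (k * t) / k\<^sup>2)"
    using c by (simp add: sup_logmgf_nonneg del: ennreal_plus)
  then show ?thesis by (simp add: c_def field_simps)
qed

text \<open>The integral operator divides \<open>exp (k t)\<close> by \<open>k\<^sup>2\<close>.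
  So the weight \<open>k = 2\<close> suffices near minus infinity, where the gap is of second order; once the
  gap vanishes there, arbitrarily large \<open>k\<close> are allowed.\<close>

lemma gap_zero:
  assumes k: "0 < k" and D: "0 \<le> D" and a: "a < ln r_star" and small: "exp (cumulant a) < k\<^sup>2"
    and bound: "\<And>t. t \<le> a \<Longrightarrow> cumulant t - sup_logmgf t \<le> D * exp (k * t)"
    and t: "t \<le> a"
  shows "sup_logmgf t = cumulant t"
proof -
  define q where "q = exp (cumulant a) / k\<^sup>2"
  have q: "0 \<le> q" "q < 1" using small k by (auto simp: q_def)
  have "cumulant s - sup_logmgf s \<le> (q ^ n * D) * exp (k * s)" if "s \<le> a" for n s
    using that
  proof (induction n arbitrary: s)
    case (Suc n)
    show ?case
      using gap_contraction[OF k _ a Suc.IH Suc.prems] q D by (simp add: q_def mult.assoc)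
  qed (use bound in auto)
  then have "cumulant t - sup_logmgf t \<le> q ^ n * D * exp (k * t)" for n
    using t by blast
  moreover have "(\<lambda>n. q ^ n * D * exp (k * t)) \<longlonglongrightarrow> 0 * D * exp (k * t)"
    using q by (intro tendsto_intros LIMSEQ_power_zero) auto
  ultimately have "cumulant t - sup_logmgf t \<le> 0 * D * exp (k * t)"
    using LIMSEQ_le_const by blast
  with sup_logmgf_le_cumulant[of t] t a show ?thesis by simp
qed

text \<open>Both solutions lie between e^t and e^t + D e^(2t) as long as
  \<open>cumulant t \<le> 1\<close>, that is, up to time \<open>log_time 1\<close>. With k = 2 the
  contraction factor is then e/4 < 1.\<close>

lemma sup_logmgf_eq_cumulant_near_bot: "\<exists>b < ln r_star. \<forall>t\<le>b. sup_logmgf t = cumulant t"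
proof -
  obtain D where D: "0 \<le> D" "\<And>t. t < ln r_star \<Longrightarrow> cumulant t \<le> 1 \<Longrightarrow> cumulant t \<le> exp t + D * exp (2 *
      t)"
    using cumulant_upper by blast
  have a: "log_time 1 < ln r_star" by (rule log_time_less) simp
  have "sup_logmgf t = cumulant t" if "t \<le> log_time 1" for t
  proof (rule gap_zero[OF _ D(1) a _ _ that])
    show "exp (cumulant (log_time 1)) < 2\<^sup>2"
      using exp_le by simp
    fix s assume s: "s \<le> log_time 1"
    then have "cumulant s \<le> 1" using cumulant_mono[OF s a] by simp
    then show "cumulant s - sup_logmgf s \<le> D * exp (2 * s)"
      using D(2)[of s] exp_le_sup_logmgf[of s] s a by simp
  qed simp
  then show ?thesis using a by blast
qed

lemma sup_logmgf_eq_cumulant: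
  assumes t: "t < ln r_star"
  shows "sup_logmgf t = cumulant t"
proof -
  obtain b where b: "b < ln r_star" "\<And>t. t \<le> b \<Longrightarrow> sup_logmgf t = cumulant t"
    using sup_logmgf_eq_cumulant_near_bot by blast
  \<comment> \<open>Any k > 1 above exp (cumulant t) will do, as then k^2 \<ge> k.\<close>
  obtain m :: nat where m: "exp (cumulant t) < real m"
    using reals_Archimedean2 by blast
  define k where "k = real m"
  have k: "1 < k" using m cumulant_nonneg[of t] unfolding k_def by (smt (verit) one_le_exp_iff)
  have "k \<le> k\<^sup>2" using k by (simp add: power2_eq_square)
  then have small: "exp (cumulant t) < k\<^sup>2" using m unfolding k_def by linarith
  show ?thesis
  proof (rule gap_zero[OF _ _ t small _ order_refl])
    show "0 < k" using k by simp
    \<comment> \<open>The constant is chosen so that the weighted bound at s reads cumulant t * exp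
      (k (s - b)). For s > b this exceeds the trivial bound \<open>cumulant t\<close>; for s \<le> b
      the gap is 0.\<close>
    show "0 \<le> cumulant t * exp (- k * b)" using cumulant_nonneg by simp
    fix s assume s: "s \<le> t"
    show "cumulant s - sup_logmgf s \<le> cumulant t * exp (- k * b) * exp (k * s)"
    proof (cases "s \<le> b")
      case True
      then show ?thesis using b(2) cumulant_nonneg by simp
    next
      case False
      then have "1 \<le> exp (- k * b) * exp (k * s)" using k by (simp flip: exp_add)
      then have "cumulant t * 1 \<le> cumulant t * (exp (- k * b) * exp (k * s))"
        by (intro mult_left_mono cumulant_nonneg)
      then show ?thesis
        using cumulant_mono[OF s t] sup_logmgf_nonneg[of s] by (simp add: mult.assoc)
    qed
  qed
qed

lemma SUP_logmgf: "t < ln r_star \<Longrightarrow> (SUP n. logmgf n t) = ennreal (cumulant t)"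
  using ennreal_sup_logmgf[of t] sup_logmgf_eq_cumulant[of t] by simp

section \<open>The branching recursion\<close>

lemma brw_W_0: "brw_W xi 0 \<omega> = 1"
proof -
  have "{u :: nat list. length u = 0} = {[]}" by auto
  then show ?thesis
    by (simp add: brw_W_def brw_pos_def nn_integral_count_space_finite)
qed

text \<open>The two families may live on different sample spaces, which allows W_n to be read off
  from the space of labelled displacements in \<open>brw_swap_child\<close>.\<close>

lemma brw_W_cong:
  assumes "\<And>v k. xi v k \<omega> = xi' v k \<omega>'"
  shows "brw_W xi n \<omega> = brw_W xi' n \<omega>'"
  unfolding brw_W_def brw_pos_def assms ..

lemma brw_pos_Cons: "brw_pos xi (k # u) \<omega> = xi [] k \<omega> + brw_pos (\<lambda>v. xi (k # v)) u \<omega>"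
  by (simp add: brw_pos_def sum.lessThan_Suc_shift del: sum.lessThan_Suc)

text \<open>The tree is cut at the root and not at the last generation: the subtrees are then
  independent of the root process and of the same kind as the whole tree.\<close>

lemma brw_W_Suc:
  "brw_W xi (Suc n) \<omega> = (\<Sum>k. ennreal (exp (- (fst (xi [] k \<omega>) + snd (xi [] k \<omega>)))) * brw_W (\<lambda>v. xi
      (k # v)) n \<omega>)"
proof -
  let ?E = "\<lambda>z :: real \<times> real. ennreal (exp (- (fst z + snd z)))"
  let ?B = "{u :: nat list. length u = n}"
  have split: "?E (brw_pos xi (k # u) \<omega>)
      = ?E (xi [] k \<omega>) * ?E (brw_pos (\<lambda>v. xi (k # v)) u \<omega>)" for k u
    by (simp add: brw_pos_Cons flip: ennreal_mult exp_add)
  have "bij_betw (\<lambda>(k, u). k # u) (UNIV \<times> ?B) {u. length u = Suc n}"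
    by (rule bij_betw_byWitness[where f'="\<lambda>u. (hd u, tl u)"]) (auto simp: length_Suc_conv)
  then have "brw_W xi (Suc n) \<omega>
      = (\<integral>\<^sup>+p. ?E (brw_pos xi (case p of (k, u) \<Rightarrow> k # u) \<omega>) \<partial>count_space (UNIV \<times> ?B))"
    unfolding brw_W_def by (rule nn_integral_bij_count_space[symmetric])
  also have "\<dots> = (\<integral>\<^sup>+p. ?E (brw_pos xi (case p of (k, u) \<Rightarrow> k # u) \<omega>) * indicator (UNIV \<times> ?B) p
      \<partial>count_space UNIV)"
    by (rule nn_integral_count_space_indicator) simp
  also have "\<dots> = (\<integral>\<^sup>+k. \<integral>\<^sup>+u. ?E (brw_pos xi (k # u) \<omega>) * indicator ?B u \<partial>count_space UNIV
      \<partial>count_space UNIV)"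
    by (subst nn_integral_fst_count_space[symmetric]) (simp add: indicator_def)
  also have "\<dots> = (\<Sum>k. \<integral>\<^sup>+u. ?E (brw_pos xi (k # u) \<omega>) * indicator ?B u \<partial>count_space UNIV)"
    by (rule nn_integral_count_space_nat)
  also have "\<dots> = (\<Sum>k. ?E (xi [] k \<omega>) * brw_W (\<lambda>v. xi (k # v)) n \<omega>)"
  proof (rule suminf_cong)
    fix k
    have "(\<integral>\<^sup>+u. ?E (brw_pos xi (k # u) \<omega>) * indicator ?B u \<partial>count_space UNIV)
        = (\<integral>\<^sup>+u. ?E (brw_pos xi (k # u) \<omega>) \<partial>count_space ?B)"
      by (rule nn_integral_count_space_indicator[symmetric]) simp
    also have "\<dots> = ?E (xi [] k \<omega>) * brw_W (\<lambda>v. xi (k # v)) n \<omega>"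
      unfolding split brw_W_def by (rule nn_integral_cmult) simp
    finally show "(\<integral>\<^sup>+u. ?E (brw_pos xi (k # u) \<omega>) * indicator ?B u \<partial>count_space UNIV)
        = ?E (xi [] k \<omega>) * brw_W (\<lambda>v. xi (k # v)) n \<omega>" .
  qed
  finally show ?thesis .
qed

lemma brw_W_measurable:
  assumes "\<And>v k. xi v k \<in> borel_measurable N"
  shows "brw_W xi n \<in> borel_measurable N"
  using assms
proof (induction n arbitrary: xi)
  case 0
  then show ?case by (simp add: brw_W_0 cong: measurable_cong)
next
  case (Suc n)
  have [measurable]: "xi v k \<in> borel_measurable N" for v k
    by (rule Suc.prems)
  have [measurable]: "brw_W (\<lambda>v. xi (k # v)) n \<in> borel_measurable N" for k
    by (rule Suc.IH) simp
  have [measurable]: "(\<lambda>\<omega>. fst (xi [] k \<omega>)) \<in> borel_measurable N" "(\<lambda>\<omega>. snd (xi [] k \<omega>)) \<in>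
      borel_measurable N" for k
    using measurable_compose[OF Suc.prems, of fst borel] measurable_compose[OF Suc.prems, of snd
        borel]
    by (auto simp: borel_prod[symmetric])
  show ?case
    unfolding brw_W_Suc[abs_def] by measurable
qed

text \<open>The law of the sequence \<open>xi v\<close> is not determined (atoms may be listed in any order,
  depending on \<open>v\<close>), so the subtrees are not identically distributed as labelled objects. The
  exponential moments are therefore computed by induction for all families at once.\<close>

definition brw_family :: "'a measure \<Rightarrow> (nat list \<Rightarrow> nat \<Rightarrow> 'a \<Rightarrow> real \<times> real) \<Rightarrow> bool" where
  "brw_family M xi \<longleftrightarrow> (\<forall>v. poisson_pp_quadrant M (xi v)) \<and>
     prob_space.indep_vars M (\<lambda>_. PiM UNIV (\<lambda>_. borel)) (\<lambda>v \<omega> k. xi v k \<omega>) UNIV"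

text \<open>Used with f = (#) k, to regard the processes in the subtree of child k as a family
  labelled by all lists again.\<close>

lemma (in prob_space) indep_vars_reindex_inj:
  assumes "indep_vars N X (f ` I)" "inj_on f I"
  shows "indep_vars (\<lambda>i. N (f i)) (\<lambda>i. X (f i)) I"
proof -
  have *: "indep_sets (\<lambda>i. F (f i)) I" if "indep_sets F (f ` I)" for F
  proof (rule indep_setsI)
    fix A J assume "J \<noteq> {}" "J \<subseteq> I" "finite J" and A: "\<forall>j\<in>J. A j \<in> F (f j)"
    have inj: "inj_on f J" using assms(2) \<open>J \<subseteq> I\<close> by (rule inj_on_subset)
    define A' where "A' = (\<lambda>k. A (the_inv_into J f k))"
    have A': "A' (f j) = A j" if "j \<in> J" for j
      using that inj by (simp add: A'_def the_inv_into_f_f)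
    have "prob (\<Inter>k\<in>f ` J. A' k) = (\<Prod>k\<in>f ` J. prob (A' k))"
      using \<open>J \<noteq> {}\<close> \<open>J \<subseteq> I\<close> \<open>finite J\<close> A A' by (intro indep_setsD[OF that]) auto
    then show "prob (\<Inter>j\<in>J. A j) = (\<Prod>j\<in>J. prob (A j))"
      using inj A' by (simp add: prod.reindex)
  qed (use that in \<open>auto simp: indep_sets_def\<close>)
  show ?thesis
    using assms(1) * unfolding indep_vars_def2 by auto
qed

lemma brw_family_subtree:
  assumes "prob_space M" "brw_family M xi"
  shows "brw_family M (\<lambda>v. xi (k # v))"
proof -
  interpret prob_space M by fact
  have "indep_vars (\<lambda>_. PiM UNIV (\<lambda>_. borel)) (\<lambda>v \<omega> i. xi v i \<omega>) ((#) k ` UNIV)"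
    using assms(2) unfolding brw_family_def by (blast intro: indep_vars_subset)
  from indep_vars_reindex_inj[OF this] assms(2) show ?thesis
    by (simp add: brw_family_def inj_on_def)
qed

lemma brw_family_measurable: "brw_family M xi \<Longrightarrow> xi v k \<in> borel_measurable M"
  unfolding brw_family_def by (blast intro: poisson_pp_measurable)

text \<open>The joint law is a product. Both integrals are written over M itself, so that a moment
  known as an integral over M can be substituted for the inner one.\<close>

lemma (in prob_space) nn_integral_indep_var:
  assumes "indep_var S X T Y" and [measurable]: "F \<in> borel_measurable (S \<Otimes>\<^sub>M T)"
  shows "(\<integral>\<^sup>+\<omega>. F (X \<omega>, Y \<omega>) \<partial>M) = (\<integral>\<^sup>+\<omega>. \<integral>\<^sup>+\<omega>'. F (X \<omega>, Y \<omega>') \<partial>M \<partial>M)"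
proof -
  have [measurable]: "X \<in> M \<rightarrow>\<^sub>M S" "Y \<in> M \<rightarrow>\<^sub>M T"
    and distr: "distr M S X \<Otimes>\<^sub>M distr M T Y = distr M (S \<Otimes>\<^sub>M T) (\<lambda>\<omega>. (X \<omega>, Y \<omega>))"
    using assms(1) unfolding indep_var_distribution_eq by auto
  interpret Y: prob_space "distr M T Y"
    by (rule prob_space_distr) simp
  have "(\<integral>\<^sup>+\<omega>. F (X \<omega>, Y \<omega>) \<partial>M) = (\<integral>\<^sup>+p. F p \<partial>(distr M S X \<Otimes>\<^sub>M distr M T Y))"
    unfolding distr by (simp add: nn_integral_distr)
  also have "\<dots> = (\<integral>\<^sup>+x. \<integral>\<^sup>+y. F (x, y) \<partial>distr M T Y \<partial>distr M S X)"
    by (rule Y.nn_integral_fst[symmetric]) simp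
  also have "\<dots> = (\<integral>\<^sup>+\<omega>. \<integral>\<^sup>+y. F (X \<omega>, y) \<partial>distr M T Y \<partial>M)"
    by (rule nn_integral_distr) (auto intro!: Y.borel_measurable_nn_integral)
  also have "\<dots> = (\<integral>\<^sup>+\<omega>. \<integral>\<^sup>+\<omega>'. F (X \<omega>, Y \<omega>') \<partial>M \<partial>M)"
    by (intro nn_integral_cong nn_integral_distr) (auto dest: measurable_space)
  finally show ?thesis .
qed

lemma nn_integral_quadrant:
  assumes [measurable]: "F \<in> borel_measurable borel"
  shows "(\<integral>\<^sup>+z\<in>quadrant. F (t - (fst z + snd z)) \<partial>lborel)
       = (\<integral>\<^sup>+x\<in>{0..}. (\<integral>\<^sup>+y\<in>{0..}. F (t - (x + y)) \<partial>lborel) \<partial>(lborel :: real measure))"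
proof -
  have AE: "AE x::real in lborel. indicator {0<..} x = (indicator {0..} x :: ennreal)"
    using AE_lborel_singleton[of "0::real"] by eventually_elim (auto simp: indicator_def)
  have [measurable]: "{0::real<..} \<times> {0::real<..} \<in> sets (lborel \<Otimes>\<^sub>M lborel)"
    by (intro pair_measureI) auto
  have "(\<integral>\<^sup>+z\<in>quadrant. F (t - (fst z + snd z)) \<partial>lborel)
      = (\<integral>\<^sup>+z. F (t - (fst z + snd z)) * indicator ({0<..} \<times> {0<..}) z \<partial>(lborel \<Otimes>\<^sub>M lborel))"
    by (simp add: lborel_prod quadrant_def)
  also have "\<dots> = (\<integral>\<^sup>+x. \<integral>\<^sup>+y. F (t - (x + y)) * indicator ({0<..} \<times> {0<..}) (x, y) \<partial>lborel \<partial>lborel)"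
    by (subst lborel.nn_integral_fst[symmetric]) auto
  also have "\<dots> = (\<integral>\<^sup>+x. (\<integral>\<^sup>+y. F (t - (x + y)) * indicator {0<..} y \<partial>lborel) * indicator {0<..} x
      \<partial>lborel)"
    by (intro nn_integral_cong) (auto simp: indicator_def)
  also have "\<dots> = (\<integral>\<^sup>+x. (\<integral>\<^sup>+y. F (t - (x + y)) * indicator {0..} y \<partial>lborel) * indicator {0<..} x
      \<partial>lborel)"
    using AE by (intro nn_integral_cong arg_cong2[where f="(*)"] refl nn_integral_cong_AE) auto
  also have "\<dots> = (\<integral>\<^sup>+x. (\<integral>\<^sup>+y. F (t - (x + y)) * indicator {0..} y \<partial>lborel) * indicator {0..} x
      \<partial>lborel)"
    using AE by (intro nn_integral_cong_AE) auto
  finally show ?thesis .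
qed

text \<open>Split the labels into B, those beginning with j, and the rest. The rest contains the
  root label and the subtrees in J, so the total Y j of subtree j is independent of all other
  factors, including the displacement of child j. With that displacement frozen, the assumption on
  the moments of Y j integrates it out.\<close>

lemma brw_swap_child:
  fixes t :: real
  assumes M: "prob_space M" and fam: "brw_family M xi"
    and IH: "\<And>t. (\<integral>\<^sup>+\<omega>. eexp (ennreal (exp t) * brw_W (\<lambda>v. xi (j # v)) n \<omega>) \<partial>M) = eexp (g t)"
    and [measurable]: "g \<in> borel_measurable borel"
    and J: "finite J" "j \<notin> J"
  defines "e \<equiv> \<lambda>k \<omega>. t - (fst (xi [] k \<omega>) + snd (xi [] k \<omega>))"
  defines "Y \<equiv> \<lambda>k \<omega>. brw_W (\<lambda>v. xi (k # v)) n \<omega>"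
  shows "(\<integral>\<^sup>+\<omega>. (\<Prod>k\<in>J. eexp (ennreal (exp (e k \<omega>)) * Y k \<omega>)) * (\<Prod>k\<in>J'. eexp (g (e k \<omega>))) * eexp
      (ennreal (exp (e j \<omega>)) * Y j \<omega>) \<partial>M)
       = (\<integral>\<^sup>+\<omega>. (\<Prod>k\<in>J. eexp (ennreal (exp (e k \<omega>)) * Y k \<omega>)) * (\<Prod>k\<in>J'. eexp (g (e k \<omega>))) * eexp (g
           (e j \<omega>)) \<partial>M)"
proof -
  interpret prob_space M by fact
  let ?P = "\<lambda>_ :: nat list. PiM UNIV (\<lambda>_ :: nat. borel :: (real \<times> real) measure)"
  let ?X = "\<lambda>\<omega> v k. xi v k \<omega>"
  define B where "B = range ((#) j)"
  \<comment> \<open>V, e' and A are the random quantities Y, e and the remaining factors, rewritten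
    as measurable functions of the labelled displacements, to which independence of the two label
    blocks applies.\<close>
  define V where "V k x = brw_W (\<lambda>v i c. c (k # v) i) n x" for k and x :: "nat list \<Rightarrow> nat \<Rightarrow> real \<times>
      real"
  define e' where "e' k x = t - (fst (x [] k) + snd (x [] k))" for k and x :: "nat list \<Rightarrow> nat \<Rightarrow>
      real \<times> real"
  define A where "A x = (\<Prod>k\<in>J. eexp (ennreal (exp (e' k x)) * V k x)) * (\<Prod>k\<in>J'. eexp (g (e' k x)))"
      for x
  have ind: "indep_var (PiM (- B) ?P) (\<lambda>\<omega>. restrict (?X \<omega>) (- B)) (PiM B ?P) (\<lambda>\<omega>. restrict (?X \<omega>)
      B)"
    using fam unfolding brw_family_def by (intro indep_var_restrict) auto
  have V_meas: "V k \<in> borel_measurable (PiM C ?P)" if "range ((#) k) \<subseteq> C" for k C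
    unfolding V_def
  proof (rule brw_W_measurable)
    fix v i
    have "(\<lambda>c. c (k # v)) \<in> PiM C ?P \<rightarrow>\<^sub>M ?P (k # v)"
      using that by (intro measurable_component_singleton) auto
    from measurable_compose[OF this measurable_component_singleton[of i]]
    show "(\<lambda>c. c (k # v) i) \<in> borel_measurable (PiM C ?P)" by simp
  qed
  have V_eq: "V k (restrict (?X \<omega>) C) = Y k \<omega>" if "range ((#) k) \<subseteq> C" for k C \<omega>
    unfolding V_def Y_def using that by (intro brw_W_cong) auto
  have e'_eq: "e' k (restrict (?X \<omega>) (- B)) = e k \<omega>" for k \<omega>
    by (auto simp: e'_def e_def B_def)
  have [measurable]: "e' k \<in> borel_measurable (PiM (- B) ?P)" for k
  proof -
    have "(\<lambda>c. c []) \<in> PiM (- B) ?P \<rightarrow>\<^sub>M ?P []"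
      by (intro measurable_component_singleton) (auto simp: B_def)
    from measurable_compose[OF this measurable_component_singleton[of k]]
    have "(\<lambda>c. c [] k) \<in> PiM (- B) ?P \<rightarrow>\<^sub>M borel \<Otimes>\<^sub>M borel" by (simp add: borel_prod)
    then show ?thesis unfolding e'_def by measurable
  qed
  have J_sub: "range ((#) k) \<subseteq> - B" if "k \<in> J" for k
    using that J by (auto simp: B_def)
  have [measurable]: "A \<in> borel_measurable (PiM (- B) ?P)"
    unfolding A_def using V_meas[OF J_sub] by measurable
  have VB [measurable]: "V j \<in> borel_measurable (PiM B ?P)"
    by (rule V_meas) (simp add: B_def)
  have A_eq: "A (restrict (?X \<omega>) (- B))
      = (\<Prod>k\<in>J. eexp (ennreal (exp (e k \<omega>)) * Y k \<omega>)) * (\<Prod>k\<in>J'. eexp (g (e k \<omega>)))" for \<omega>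
    unfolding A_def e'_eq using V_eq[OF J_sub] by (simp cong: prod.cong)
  have Y_meas [measurable]: "Y j \<in> borel_measurable M"
    unfolding Y_def using brw_family_measurable[OF fam] by (intro brw_W_measurable) auto
  have IH': "(\<integral>\<^sup>+\<omega>. eexp (ennreal (exp s) * Y j \<omega>) \<partial>M) = eexp (g s)" for s
    unfolding Y_def by (rule IH)
  define F where "F = (\<lambda>(x, y). A x * eexp (ennreal (exp (e' j x)) * V j y))"
  have [measurable]: "F \<in> borel_measurable (PiM (- B) ?P \<Otimes>\<^sub>M PiM B ?P)"
    unfolding F_def by measurable
  have VBY: "V j (restrict (?X \<omega>) B) = Y j \<omega>" for \<omega>
    by (rule V_eq) (simp add: B_def)
  have "(\<integral>\<^sup>+\<omega>. F (restrict (?X \<omega>) (- B), restrict (?X \<omega>) B) \<partial>M)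
      = (\<integral>\<^sup>+\<omega>. \<integral>\<^sup>+\<omega>'. F (restrict (?X \<omega>) (- B), restrict (?X \<omega>') B) \<partial>M \<partial>M)"
    by (rule nn_integral_indep_var[OF ind]) simp
  also have "\<dots> = (\<integral>\<^sup>+\<omega>. A (restrict (?X \<omega>) (- B)) * eexp (g (e j \<omega>)) \<partial>M)"
    by (simp add: F_def VBY e'_eq nn_integral_cmult IH')
  finally show ?thesis
    by (simp add: F_def VBY e'_eq A_eq)
qed

text \<open>Hybrid products: children below j keep their actual subtree, the others already carry
  the conditional moment. One swap leads from j to j + 1; j = 0 and j = K are the two sides.\<close>

lemma brw_prod_children:
  fixes t :: real
  assumes M: "prob_space M" and fam: "brw_family M xi"
    and IH: "\<And>j t. (\<integral>\<^sup>+\<omega>. eexp (ennreal (exp t) * brw_W (\<lambda>v. xi (j # v)) n \<omega>) \<partial>M) = eexp (g t)"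
    and g: "g \<in> borel_measurable borel"
  defines "e \<equiv> \<lambda>k \<omega>. t - (fst (xi [] k \<omega>) + snd (xi [] k \<omega>))"
  shows "(\<integral>\<^sup>+\<omega>. (\<Prod>k<K. eexp (ennreal (exp (e k \<omega>)) * brw_W (\<lambda>v. xi (k # v)) n \<omega>)) \<partial>M)
       = (\<integral>\<^sup>+\<omega>. (\<Prod>k<K. eexp (g (e k \<omega>))) \<partial>M)"
proof -
  have "(\<integral>\<^sup>+\<omega>. (\<Prod>k<j. eexp (ennreal (exp (e k \<omega>)) * brw_W (\<lambda>v. xi (k # v)) n \<omega>)) * (\<Prod>k\<in>{j..<K}.
      eexp (g (e k \<omega>))) \<partial>M)
       = (\<integral>\<^sup>+\<omega>. (\<Prod>k<K. eexp (g (e k \<omega>))) \<partial>M)" if "j \<le> K" for j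
    using that
  proof (induction j)
    case 0
    then show ?case by (simp add: atLeast0LessThan)
  next
    case (Suc j)
    have "{j..<K} = insert j {Suc j..<K}" using Suc.prems by auto
    with brw_swap_child[OF M fam IH g, where J="{..<j}" and j=j and t=t and J'="{Suc j..<K}"] Suc
        show ?case
      by (simp add: e_def lessThan_Suc mult_ac)
  qed
  from this[of K] show ?thesis by simp
qed

text \<open>Induction over n for all families at once. Truncation at K children makes the swap
  argument finite, and monotone convergence, for factors at least 1, removes the truncation.\<close>

lemma brw_W_mgf:
  assumes M: "prob_space M" and "brw_family M xi"
  shows "(\<integral>\<^sup>+\<omega>. eexp (ennreal (exp t) * brw_W xi n \<omega>) \<partial>M) = eexp (logmgf n t)"
  using assms(2)
proof (induction n arbitrary: xi t)
  case 0
  interpret prob_space M by fact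
  show ?case by (simp add: brw_W_0 emeasure_space_1)
next
  case (Suc n)
  note fam = Suc.prems
  have IH: "(\<integral>\<^sup>+\<omega>. eexp (ennreal (exp t) * brw_W (\<lambda>v. xi (j # v)) n \<omega>) \<partial>M)
      = eexp (logmgf n t)" for j t
    by (rule Suc.IH[OF brw_family_subtree[OF M fam]])
  define e where "e k \<omega> = t - (fst (xi [] k \<omega>) + snd (xi [] k \<omega>))" for k \<omega>
  let ?Y = "\<lambda>k. brw_W (\<lambda>v. xi (k # v)) n"
  have xi_meas: "xi v k \<in> M \<rightarrow>\<^sub>M borel \<Otimes>\<^sub>M borel" for v k
    using brw_family_measurable[OF fam] by (simp add: borel_prod)
  have [measurable]: "e k \<in> borel_measurable M" for k
    unfolding e_def using xi_meas[of "[]" k] by measurable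
  have [measurable]: "?Y k \<in> borel_measurable M" for k
    using brw_family_measurable[OF fam] by (intro brw_W_measurable) auto
  have one_le: "1 \<le> eexp w" for w
    by (simp add: eexp_def)
  have inc: "incseq (\<lambda>K \<omega>. \<Prod>k<K. f k \<omega>)" if "\<And>k \<omega>. 1 \<le> (f k \<omega> :: ennreal)" for f :: "nat \<Rightarrow> 'a \<Rightarrow>
      ennreal"
    using mult_left_mono[OF that, of "\<Prod>k<_. f k _"] by (intro incseq_SucI le_funI) simp
  have mult_exp: "ennreal (exp t) * (ennreal (exp (- d)) * y) = ennreal (exp (t - d)) * y" for d y
    by (simp add: exp_diff exp_minus divide_inverse mult.assoc[symmetric] ennreal_mult[symmetric])
  have "ennreal (exp t) * brw_W xi (Suc n) \<omega> = (\<Sum>k. ennreal (exp (e k \<omega>)) * ?Y k \<omega>)" for \<omega>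
    unfolding brw_W_Suc e_def by (subst ennreal_suminf_cmult[symmetric]) (simp only: mult_exp)
  then have "(\<integral>\<^sup>+\<omega>. eexp (ennreal (exp t) * brw_W xi (Suc n) \<omega>) \<partial>M)
      = (\<integral>\<^sup>+\<omega>. (SUP K. \<Prod>k<K. eexp (ennreal (exp (e k \<omega>)) * ?Y k \<omega>)) \<partial>M)"
    by (simp add: eexp_suminf)
  also have "\<dots> = (SUP K. \<integral>\<^sup>+\<omega>. (\<Prod>k<K. eexp (ennreal (exp (e k \<omega>)) * ?Y k \<omega>)) \<partial>M)"
    by (intro nn_integral_monotone_convergence_SUP inc one_le) measurable
  also have "\<dots> = (SUP K. \<integral>\<^sup>+\<omega>. (\<Prod>k<K. eexp (logmgf n (e k \<omega>))) \<partial>M)"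
    unfolding e_def by (simp only: brw_prod_children[OF M fam IH logmgf_measurable])
  also have "\<dots> = (\<integral>\<^sup>+\<omega>. (SUP K. \<Prod>k<K. eexp (logmgf n (e k \<omega>))) \<partial>M)"
    by (intro nn_integral_monotone_convergence_SUP[symmetric] inc one_le) measurable
  also have "\<dots> = (\<integral>\<^sup>+\<omega>. eexp (\<Sum>k. logmgf n (t - (fst (xi [] k \<omega>) + snd (xi [] k \<omega>)))) \<partial>M)"
    by (simp add: eexp_suminf e_def)
  \<comment> \<open>Only the root process is left, with a deterministic function of each atom, so
    Campbell's formula applies.\<close>
  also have "\<dots> = eexp (\<integral>\<^sup>+z\<in>quadrant. em1 (logmgf n (t - (fst z + snd z))) \<partial>lborel)"
  proof (rule poisson_campbell[OF M, where g="\<lambda>z. logmgf n (t - (fst z + snd z))"])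
    show "poisson_pp_quadrant M (xi [])"
      using fam by (simp add: brw_family_def)
    show "(\<lambda>z. logmgf n (t - (fst z + snd z))) \<in> borel_measurable borel"
      unfolding borel_prod[symmetric] by measurable
  qed
  also have "(\<integral>\<^sup>+z\<in>quadrant. em1 (logmgf n (t - (fst z + snd z))) \<partial>lborel) = logmgf (Suc n) t"
    unfolding logmgf.simps iterate_exp_def
        by (rule nn_integral_quadrant[where F="\<lambda>s. em1 (logmgf n s)"]) measurable
  finally show ?case .
qed

text \<open>A quantitative uniform integrability: where w > K, a larger exponent s' buys the small
  factor exp (-(e^s' - e^s) K).\<close>

lemma eexp_truncate:
  assumes "s \<le> s'"
  shows "eexp (ennreal (exp s) * w) \<le> eexp (ennreal (exp s) * min w (ennreal K))
    + ennreal (exp (- (exp s' - exp s) * K)) * eexp (ennreal (exp s') * w)"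
proof (cases "w \<le> ennreal K")
  case True
  then show ?thesis by (simp add: min_absorb1)
next
  case False
  show ?thesis
  proof (cases w)
    case (real x)
    then have x: "0 \<le> x" "K < x"
      using False by (auto simp: ennreal_le_iff2)
    have "exp (exp s * x) = exp (- (exp s' - exp s) * x) * exp (exp s' * x)"
      by (simp add: algebra_simps flip: exp_add)
    also have "\<dots> \<le> exp (- (exp s' - exp s) * K) * exp (exp s' * x)"
    proof (intro mult_right_mono)
      have "(exp s' - exp s) * K \<le> (exp s' - exp s) * x"
        using x assms by (intro mult_left_mono) auto
      then show "exp (- (exp s' - exp s) * x) \<le> exp (- (exp s' - exp s) * K)"
        by (simp add: algebra_simps)
    qed simp
    finally show ?thesis
      using x unfolding real
      by (intro add_increasing) (auto simp flip: ennreal_mult intro!: ennreal_leI)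
  qed (simp add: ennreal_mult_top)
qed

text \<open>Fatou gives \<le>. For \<ge>, mass could escape to infinity in the limit; an s strictly
  between t and \<open>ln r_star\<close> has uniformly bounded moments, so by
  \<open>eexp_truncate\<close> the loss from cutting W_n off at K is exponentially small in K,
  uniformly in n.\<close>

lemma brw_limit_mgf:
  assumes M: "prob_space M" and fam: "brw_family M xi"
    and [measurable]: "V \<in> borel_measurable M" and V: "\<And>\<omega>. 0 \<le> V \<omega>"
    and lim: "AE \<omega> in M. (\<lambda>n. brw_W xi n \<omega>) \<longlonglongrightarrow> ennreal (V \<omega>)"
    and t: "t < ln r_star"
  shows "(\<integral>\<^sup>+\<omega>. ennreal (exp (exp t * V \<omega>)) \<partial>M) = ennreal (exp (cumulant t))"
proof -
  interpret prob_space M by fact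
  let ?X = "brw_W xi"
  have [measurable]: "?X n \<in> borel_measurable M" for n
    using brw_family_measurable[OF fam] by (intro brw_W_measurable)
  have V_eexp: "ennreal (exp (c * V \<omega>)) = eexp (ennreal c * ennreal (V \<omega>))" if "0 \<le> c" for c \<omega>
    using V that by (simp flip: ennreal_mult)
  have mult_lim: "((\<lambda>n. ennreal c * f n) \<longlongrightarrow> ennreal c * l) sequentially" if "f \<longlonglongrightarrow> l" for c f l
    using that by (intro ennreal_tendsto_cmult) auto
  have mgf_le: "(\<integral>\<^sup>+\<omega>. eexp (ennreal (exp s) * ?X n \<omega>) \<partial>M) \<le> ennreal (exp (cumulant s))" if "s < ln
      r_star" for s n
    using eexp_mono[OF logmgf_le_cumulant[OF that]] cumulant_nonneg
        by (simp add: brw_W_mgf[OF M fam])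
  show ?thesis
  proof (rule antisym)
    have "(\<integral>\<^sup>+\<omega>. ennreal (exp (exp t * V \<omega>)) \<partial>M)
        = (\<integral>\<^sup>+\<omega>. liminf (\<lambda>n. eexp (ennreal (exp t) * ?X n \<omega>)) \<partial>M)"
    proof (rule nn_integral_cong_AE)
      show "AE \<omega> in M. ennreal (exp (exp t * V \<omega>)) = liminf (\<lambda>n. eexp (ennreal (exp t) * ?X n \<omega>))"
        using lim
      proof eventually_elim
        case (elim \<omega>)
        have "(\<lambda>n. ennreal (exp t) * ?X n \<omega>) \<longlonglongrightarrow> ennreal (exp t * V \<omega>)"
          using mult_lim[OF elim] V by (simp add: ennreal_mult)
        then have "(\<lambda>n. eexp (ennreal (exp t) * ?X n \<omega>)) \<longlonglongrightarrow> eexp (ennreal (exp t * V \<omega>))"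
          using V by (intro tendsto_eexp) auto
        then show ?case
          using V lim_imp_Liminf[OF sequentially_bot] by fastforce
      qed
    qed
    also have "\<dots> \<le> liminf (\<lambda>n. \<integral>\<^sup>+\<omega>. eexp (ennreal (exp t) * ?X n \<omega>) \<partial>M)"
      by (rule nn_integral_liminf) measurable
    also have "\<dots> \<le> ennreal (exp (cumulant t))"
      by (intro Liminf_le) (use mgf_le[OF t] in auto)
    finally show "(\<integral>\<^sup>+\<omega>. ennreal (exp (exp t * V \<omega>)) \<partial>M) \<le> ennreal (exp (cumulant t))" .
  next
    obtain s where s: "t < s" "s < ln r_star" using dense[OF t] by blast
    define d where "d = exp s - exp t"
    have d: "0 < d" using s by (simp add: d_def)
    let ?I = "\<integral>\<^sup>+\<omega>. ennreal (exp (exp t * V \<omega>)) \<partial>M"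
    have K: "ennreal (exp (cumulant t)) \<le> ?I + ennreal (exp (- d * real K)) * ennreal (exp
        (cumulant s))" for K :: nat
    proof -
      let ?T = "\<lambda>n \<omega>. eexp (ennreal (exp t) * min (?X n \<omega>) (ennreal (real K)))"
      have "(\<lambda>n. eexp (logmgf n t)) \<longlonglongrightarrow> (SUP n. eexp (logmgf n t))"
        using incseq_logmgf by (intro LIMSEQ_SUP) (auto simp: incseq_def intro: eexp_mono)
      also have "(SUP n. eexp (logmgf n t)) = ennreal (exp (cumulant t))"
        using cumulant_nonneg by (simp add: SUP_logmgf[OF t] flip: eexp_SUP[OF incseq_logmgf])
      finally have L: "(\<lambda>n. eexp (logmgf n t)) \<longlonglongrightarrow> ennreal (exp (cumulant t))" .
      have "(\<lambda>n. \<integral>\<^sup>+\<omega>. ?T n \<omega> \<partial>M) \<longlonglongrightarrow> (\<integral>\<^sup>+\<omega>. eexp (ennreal (exp t) * min (ennreal (V \<omega>)) (ennreal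
          (real K))) \<partial>M)"
      proof (rule nn_integral_dominated_convergence[where w="\<lambda>_. eexp (ennreal (exp t) * ennreal
          (real K))"])
        show "(\<integral>\<^sup>+\<omega>. eexp (ennreal (exp t) * ennreal (real K)) \<partial>M) < \<infinity>"
          by (simp add: emeasure_space_1 flip: ennreal_mult)
        show "AE \<omega> in M. (\<lambda>n. ?T n \<omega>) \<longlonglongrightarrow> eexp (ennreal (exp t) * min (ennreal (V \<omega>)) (ennreal (real
            K)))"
          using lim
        proof eventually_elim
          case (elim \<omega>)
          have eq: "ennreal (exp t) * min (ennreal (V \<omega>)) (ennreal (real K))
              = ennreal (exp t * min (V \<omega>) (real K))"
            using V by (simp add: ennreal_mult min_def ennreal_le_iff)
          have "(\<lambda>n. ennreal (exp t) * min (?X n \<omega>) (ennreal (real K))) \<longlonglongrightarrow> ennreal (exp t) * min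
              (ennreal (V \<omega>)) (ennreal (real K))"
            by (intro mult_lim tendsto_min elim tendsto_const)
          then show ?case
            unfolding eq using V by (intro tendsto_eexp) auto
        qed
      qed (auto intro!: AE_I2 eexp_mono mult_left_mono)
      then have R: "(\<lambda>n. (\<integral>\<^sup>+\<omega>. ?T n \<omega> \<partial>M) + ennreal (exp (- d * real K)) * ennreal (exp (cumulant
          s)))
          \<longlonglongrightarrow> (\<integral>\<^sup>+\<omega>. eexp (ennreal (exp t) * min (ennreal (V \<omega>)) (ennreal (real K))) \<partial>M) + ennreal
              (exp (- d * real K)) * ennreal (exp (cumulant s))"
        by (intro tendsto_add tendsto_const)
      have "ennreal (exp (cumulant t)) \<le> (\<integral>\<^sup>+\<omega>. eexp (ennreal (exp t) * min (ennreal (V \<omega>))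
          (ennreal (real K))) \<partial>M) + ennreal (exp (- d * real K)) * ennreal (exp (cumulant s))"
      proof (rule LIMSEQ_le[OF L R], intro exI allI impI)
        fix n :: nat
        have "eexp (logmgf n t) = (\<integral>\<^sup>+\<omega>. eexp (ennreal (exp t) * ?X n \<omega>) \<partial>M)"
          by (rule brw_W_mgf[OF M fam, symmetric])
        also have "\<dots> \<le> (\<integral>\<^sup>+\<omega>. ?T n \<omega> + ennreal (exp (- d * real K)) * eexp (ennreal (exp s) * ?X n
            \<omega>) \<partial>M)"
          unfolding d_def using s by (intro nn_integral_mono eexp_truncate) auto
        also have "\<dots> = (\<integral>\<^sup>+\<omega>. ?T n \<omega> \<partial>M) + ennreal (exp (- d * real K)) * (\<integral>\<^sup>+\<omega>. eexp (ennreal (exp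
            s) * ?X n \<omega>) \<partial>M)"
          by (simp add: nn_integral_add nn_integral_cmult)
        also have "\<dots> \<le> (\<integral>\<^sup>+\<omega>. ?T n \<omega> \<partial>M) + ennreal (exp (- d * real K)) * ennreal (exp (cumulant
            s))"
          by (intro add_left_mono mult_left_mono mgf_le s) auto
        finally show "eexp (logmgf n t) \<le> (\<integral>\<^sup>+\<omega>. ?T n \<omega> \<partial>M) + ennreal (exp (- d * real K)) *
            ennreal (exp (cumulant s))" .
      qed
      also have "\<dots> \<le> ?I + ennreal (exp (- d * real K)) * ennreal (exp (cumulant s))"
        by (intro add_right_mono nn_integral_mono) (auto simp: V_eexp intro!: eexp_mono
            mult_left_mono)
      finally show ?thesis .
    qed
    have "(\<lambda>K. exp (- d * real K)) \<longlonglongrightarrow> 0"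
      using d by real_asymp
    then have "(\<lambda>K. ?I + ennreal (exp (- d * real K) * exp (cumulant s))) \<longlonglongrightarrow> ?I + ennreal (0 * exp
        (cumulant s))"
      by (intro tendsto_add tendsto_const tendsto_ennrealI tendsto_mult)
    then have "(\<lambda>K. ?I + ennreal (exp (- d * real K)) * ennreal (exp (cumulant s))) \<longlonglongrightarrow> ?I"
      by (simp add: ennreal_mult)
    then show "ennreal (exp (cumulant t)) \<le> ?I"
      by (rule LIMSEQ_le_const) (use K in blast)
  qed
qed

section \<open>The Tauberian argument\<close>

text \<open>\<open>erlang_density 1 1\<close> is y exp (- y), of shape 2. Tilting by exp (- i y)
  gives the density of rate i + 1 up to the factor 1 / (i + 1)^2.\<close>

lemma integral_gamma_exp:
  "has_bochner_integral (density lborel (erlang_density 1 1)) (\<lambda>y. exp (- real i * y)) (1 / (real i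
      + 1)\<^sup>2)"
proof (rule has_bochner_integral_nn_integral)
  interpret N: prob_space "density lborel (erlang_density 1 (real i + 1))"
    by (rule prob_space_erlang_density) simp
  have eq: "erlang_density 1 1 y * exp (- (real i * y))
      = erlang_density 1 (real i + 1) y / (real i + 1)\<^sup>2" for y
  proof -
    have "exp (- y) * exp (- (real i * y)) = exp ((- real i - 1) * y)"
      by (simp add: algebra_simps flip: exp_add)
    then show ?thesis
      by (simp add: erlang_density_def power2_eq_square mult.assoc)
  qed
  have "(\<integral>\<^sup>+y. ennreal (exp (- real i * y)) \<partial>density lborel (erlang_density 1 1))
      = (\<integral>\<^sup>+y. ennreal (1 / (real i + 1)\<^sup>2) * ennreal (erlang_density 1 (real i + 1) y) \<partial>lborel)"
    by (subst nn_integral_density) (auto intro!: nn_integral_cong simp: eq[unfolded One_nat_def]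
        simp flip: ennreal_mult)
  also have "\<dots> = ennreal (1 / (real i + 1)\<^sup>2) * (\<integral>\<^sup>+y. ennreal (erlang_density 1 (real i + 1) y)
      \<partial>lborel)"
    by (rule nn_integral_cmult) simp
  also have "(\<integral>\<^sup>+y. ennreal (erlang_density 1 (real i + 1) y) \<partial>lborel) = 1"
    using N.emeasure_space_1 by (simp add: emeasure_density)
  finally show "(\<integral>\<^sup>+y. ennreal (exp (- real i * y)) \<partial>density lborel (erlang_density 1 1))
      = ennreal (1 / (real i + 1)\<^sup>2)"
    by simp
qed auto

text \<open>By Weierstrass, a polynomial in \<open>exp (- w)\<close> below the indicator
  of \<open>(1, 1 + \<epsilon>)\<close>. The second sum is its integral against \<open>w exp (- w)\<close>, the scaling limit
  of the measures in the Tauberian argument.\<close>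

lemma karamata_polynomial:
  assumes "0 < (\<epsilon> :: real)"
  obtains a :: "nat \<Rightarrow> real" and n where
    "\<And>w. 0 \<le> w \<Longrightarrow> (\<Sum>i\<le>n. a i * exp (- w) ^ i) \<le> (if 1 < w \<and> w < 1 + \<epsilon> then 1 else 0)"
    "0 < (\<Sum>i\<le>n. a i / (real i + 1)\<^sup>2)"
proof -
  let ?N = "density lborel (erlang_density 1 1)"
  interpret N: prob_space ?N
    by (rule prob_space_erlang_density) simp
  \<comment> \<open>In the variable t = exp (- w), the positive part of a parabola with roots at w =
    1 and w = 1 + \<epsilon>: a continuous minorant of the indicator, positive exactly
    inside.\<close>
  define b where "b t = max 0 ((exp (- 1) - t) * (t - exp (- (1 + \<epsilon>))))" for t :: real
  have b_cont: "continuous_on A b" for A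
    unfolding b_def by (intro continuous_intros)
  have [measurable]: "b \<in> borel_measurable borel"
    by (rule borel_measurable_continuous_onI[OF b_cont])
  have b_pos: "0 < b (exp (- w)) \<longleftrightarrow> 1 < w \<and> w < 1 + \<epsilon>" for w
    using assms by (auto simp: b_def zero_less_mult_iff max_def)
  have b_ge: "0 \<le> b t" for t by (simp add: b_def)
  have b_le: "b t \<le> 1" if "0 \<le> t" "t \<le> 1" for t
  proof -
    have e: "0 \<le> exp (- 1 :: real)" "exp (- 1 :: real) \<le> 1" "0 \<le> exp (- (1 + \<epsilon>))" "exp (- (1 + \<epsilon>))
        \<le> 1"
      using assms by auto
    have "\<bar>exp (- 1) - t\<bar> \<le> 1" "\<bar>t - exp (- (1 + \<epsilon>))\<bar> \<le> 1"
      using e that by linarith+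
    then have "\<bar>(exp (- 1) - t) * (t - exp (- (1 + \<epsilon>)))\<bar> \<le> 1 * 1"
      unfolding abs_mult by (intro mult_mono) auto
    then show ?thesis by (simp add: b_def)
  qed
  have b_bd: "norm (b (exp (- y))) \<le> 1" if "0 \<le> y" for y
    using b_le[of "exp (- y)"] b_ge[of "exp (- y)"] that by simp
  have AE_nonneg: "AE y in ?N. 0 \<le> y"
    by (subst AE_density) (auto simp: erlang_density_def)
  have b_int: "integrable ?N (\<lambda>y. b (exp (- y)))"
    using AE_nonneg by (intro N.integrable_const_bound[where B=1]) (auto elim!: eventually_mono
        simp: b_bd[simplified])
  define \<beta> where "\<beta> = (\<integral>y. b (exp (- y)) \<partial>?N)"
  have "\<beta> \<noteq> 0"
  proof
    assume "\<beta> = 0"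
    then have "AE y in ?N. b (exp (- y)) = 0"
      using integral_nonneg_eq_0_iff_AE[OF b_int] b_ge by (simp add: \<beta>_def)
    then have "AE y in lborel. y \<notin> {1<..<1 + \<epsilon>}"
      by (subst (asm) AE_density) (auto simp: erlang_density_def elim!: eventually_mono dest:
          b_pos[THEN iffD2, OF conjI])
    then have "emeasure lborel {1<..<1 + \<epsilon>} = 0"
      by (subst (asm) AE_iff_measurable[of "{1<..<1 + \<epsilon>}"]) auto
    then show False using assms by simp
  qed
  moreover have "0 \<le> \<beta>" unfolding \<beta>_def using b_ge by simp
  ultimately have \<beta>: "0 < \<beta>" by simp
  obtain g where g: "real_polynomial_function g" "\<And>t. t \<in> {0..1} \<Longrightarrow> \<bar>b t - g t\<bar> < \<beta> / 4"
    using Stone_Weierstrass_real_polynomial_function[of "{0..1::real}" b "\<beta> / 4"] b_cont \<beta> by auto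
  \<comment> \<open>Lowering g by \<beta>/4 puts it below b, at a total distance of at most
    \<beta>/2, so that its integral is still at least \<beta>/2.\<close>
  from g(1) have "real_polynomial_function (\<lambda>t. g t - \<beta> / 4)" by auto
  then obtain a n where a: "(\<lambda>t. g t - \<beta> / 4) = (\<lambda>t. \<Sum>i\<le>n. a i * t ^ i)"
    unfolding real_polynomial_function_iff_sum by blast
  have q: "(\<Sum>i\<le>n. a i * t ^ i) \<le> b t" "b t - \<beta> / 2 \<le> (\<Sum>i\<le>n. a i * t ^ i)" if "t \<in> {0..1}" for t
    using g(2)[OF that] fun_cong[OF a, of t] by linarith+
  show thesis
  proof
    fix w :: real assume w: "0 \<le> w"
    have "(\<Sum>i\<le>n. a i * exp (- w) ^ i) \<le> b (exp (- w))" using w by (intro q) auto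
    also have "\<dots> \<le> (if 1 < w \<and> w < 1 + \<epsilon> then 1 else 0)"
      using b_le[of "exp (- w)"] b_pos[of w] w by auto
    finally show "(\<Sum>i\<le>n. a i * exp (- w) ^ i) \<le> (if 1 < w \<and> w < 1 + \<epsilon> then 1 else 0)" .
  next
    have hb: "has_bochner_integral ?N (\<lambda>y. \<Sum>i\<le>n. a i * exp (- y) ^ i) (\<Sum>i\<le>n. a i * (1 / (real i +
        1)\<^sup>2))"
      using integral_gamma_exp
      by (intro has_bochner_integral_sum has_bochner_integral_mult_right) (simp add:
          exp_of_nat_mult[symmetric])
    have "(\<integral>y. b (exp (- y)) - \<beta> / 2 \<partial>?N) = (\<integral>y. b (exp (- y)) \<partial>?N) - (\<integral>y. \<beta> / 2 \<partial>?N)"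
      by (rule Bochner_Integration.integral_diff[OF b_int N.integrable_const])
    also have "\<dots> = \<beta> - \<beta> / 2"
      unfolding \<beta>_def[symmetric] using N.prob_space by simp
    finally have "\<beta> - \<beta> / 2 = (\<integral>y. b (exp (- y)) - \<beta> / 2 \<partial>?N)" ..
    also have "\<dots> \<le> (\<integral>y. (\<Sum>i\<le>n. a i * exp (- y) ^ i) \<partial>?N)"
    proof (rule integral_mono_AE)
      show "AE y in ?N. b (exp (- y)) - \<beta> / 2 \<le> (\<Sum>i\<le>n. a i * exp (- y) ^ i)"
        using AE_nonneg by eventually_elim (intro q, simp)
      show "integrable ?N (\<lambda>y. b (exp (- y)) - \<beta> / 2)"
        by (intro Bochner_Integration.integrable_diff b_int N.integrable_const)
    qed (use hb in \<open>simp add: has_bochner_integral_iff\<close>)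
    also have "\<dots> = (\<Sum>i\<le>n. a i * (1 / (real i + 1)\<^sup>2))"
      using hb by (simp add: has_bochner_integral_iff)
    finally show "0 < (\<Sum>i\<le>n. a i / (real i + 1)\<^sup>2)"
      using \<beta> by simp
  qed
qed

text \<open>At scale x the measure e^(r w) P(V \<in> dw) has Laplace transform \<psi> (r -
  \<lambda>/x) ~ C x^2 / \<lambda>^2, so the minorant from \<open>karamata_polynomial\<close> finds
  mass of order x^2 on x < w < (1 + \<epsilon>) x. There the weight is at most e^(r (1 + \<epsilon>)
  x).\<close>

lemma (in prob_space) tail_lower_bound:
  assumes [measurable]: "V \<in> borel_measurable M" and V: "\<And>\<omega>. 0 \<le> V \<omega>" and r: "0 < r" and C: "0 < C"
    and mgf: "\<And>s. 0 < s \<Longrightarrow> s < r \<Longrightarrow> has_bochner_integral M (\<lambda>\<omega>. exp (s * V \<omega>)) (\<psi> s)"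
    and blowup: "((\<lambda>s. (r - s)\<^sup>2 * \<psi> s) \<longlongrightarrow> C) (at_left r)"
    and \<epsilon>: "0 < \<epsilon>"
  shows "\<exists>c>0. \<forall>\<^sub>F x in at_top. c * exp (- r * (1 + \<epsilon>) * x) \<le> prob {\<omega> \<in> space M. V \<omega> > x}"
proof -
  obtain a n where bump: "\<And>w. 0 \<le> w \<Longrightarrow> (\<Sum>i\<le>n. a i * exp (- w) ^ i) \<le> (if 1 < w \<and> w < 1 + \<epsilon> then 1
      else 0)"
    and pos: "0 < (\<Sum>i\<le>n. a i / (real i + 1)\<^sup>2)"
    using karamata_polynomial[OF \<epsilon>] by blast
  define S where "S = (\<Sum>i\<le>n. a i / (real i + 1)\<^sup>2)"
  \<comment> \<open>This is E [exp (r V) exp (- V/x) q (exp (- V/x))] for the polynomial q with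
    coefficients a. The extra exp (- V/x) shifts i to i + 1, so every argument of \<psi> stays
    strictly below r, also for i = 0.\<close>
  define \<Phi> where "\<Phi> x = (\<Sum>i\<le>n. a i * \<psi> (r - (real i + 1) / x))" for x
  have "((\<lambda>x. \<Sum>i\<le>n. a i / (real i + 1)\<^sup>2 * ((r - (r - (real i + 1) / x))\<^sup>2 * \<psi> (r - (real i + 1) /
      x))) \<longlongrightarrow> (\<Sum>i\<le>n. a i / (real i + 1)\<^sup>2 * C)) at_top"
  proof (intro tendsto_sum tendsto_mult tendsto_const)
    fix i
    have "filterlim (\<lambda>x. r - (real i + 1) / x) (at_left r) at_top"
      by real_asymp
    from filterlim_compose[OF blowup this]
    show "((\<lambda>x. (r - (r - (real i + 1) / x))\<^sup>2 * \<psi> (r - (real i + 1) / x)) \<longlongrightarrow> C) at_top" .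
  qed
  moreover have "(\<Sum>i\<le>n. a i / (real i + 1)\<^sup>2 * ((r - (r - (real i + 1) / x))\<^sup>2 * \<psi> (r - (real i +
      1) / x))) = \<Phi> x / x\<^sup>2" for x
    unfolding \<Phi>_def sum_divide_distrib by (intro sum.cong) (auto simp: power_divide)
  ultimately have lim: "((\<lambda>x. \<Phi> x / x\<^sup>2) \<longlongrightarrow> S * C) at_top"
    by (simp add: S_def sum_distrib_right)
  have SC: "0 < S * C" using pos C unfolding S_def by (rule mult_pos_pos)
  then have "S * C / 2 < S * C" by linarith
  from order_tendstoD(1)[OF lim this] have ev1: "\<forall>\<^sub>F x in at_top. S * C / 2 < \<Phi> x / x\<^sup>2" .
  have "\<forall>\<^sub>F x in at_top. S * C / 2 * exp (- r * (1 + \<epsilon>) * x) \<le> prob {\<omega> \<in> space M. V \<omega> > x}"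
    using ev1 eventually_ge_at_top[of 1] eventually_gt_at_top[of "(real n + 1) / r"]
  proof eventually_elim
    case (elim x)
    have x: "0 < x" "1 \<le> x" using elim by auto
    have s: "0 < r - (real i + 1) / x" "r - (real i + 1) / x < r" if "i \<le> n" for i
    proof -
      have "(real n + 1) / x < r" using elim r x by (simp add: field_simps)
      moreover have "(real i + 1) / x \<le> (real n + 1) / x"
          using that x by (intro divide_right_mono) auto
      ultimately show "0 < r - (real i + 1) / x" by simp
      show "r - (real i + 1) / x < r" using x by simp
    qed
    let ?f = "\<lambda>\<omega>. \<Sum>i\<le>n. a i * exp ((r - (real i + 1) / x) * V \<omega>)"
    let ?A = "{\<omega> \<in> space M. V \<omega> > x}"
    have hb: "has_bochner_integral M ?f (\<Phi> x)"
      unfolding \<Phi>_def by (intro has_bochner_integral_sum has_bochner_integral_mult_right mgf) (use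
          s in auto)
    have f_eq: "?f \<omega> = exp (r * V \<omega>) * exp (- (V \<omega> / x)) * (\<Sum>i\<le>n. a i * exp (- (V \<omega> / x)) ^ i)" for
        \<omega>
      unfolding sum_distrib_left
      by (intro sum.cong refl) (simp add: algebra_simps add_divide_distrib flip: exp_add
          exp_of_nat_mult)
    have "\<Phi> x = (\<integral>\<omega>. ?f \<omega> \<partial>M)"
      using hb by (simp add: has_bochner_integral_iff)
    also have "\<dots> \<le> (\<integral>\<omega>. exp (r * (1 + \<epsilon>) * x) * indicator ?A \<omega> \<partial>M)"
    proof (rule integral_mono)
      show "integrable M ?f" using hb by (simp add: has_bochner_integral_iff)
      show "integrable M (\<lambda>\<omega>. exp (r * (1 + \<epsilon>) * x) * indicator ?A \<omega>)"
        by (intro integrable_mult_right integrable_real_indicator) (auto simp: emeasure_eq_measure)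
      fix \<omega> assume \<omega>: "\<omega> \<in> space M"
      let ?w = "V \<omega> / x"
      have w: "0 \<le> ?w" using V x by simp
      have "?f \<omega> \<le> exp (r * V \<omega>) * exp (- ?w) * (if 1 < ?w \<and> ?w < 1 + \<epsilon> then 1 else 0)"
        unfolding f_eq by (intro mult_left_mono bump w) auto
      also have "\<dots> \<le> exp (r * (1 + \<epsilon>) * x) * indicator ?A \<omega>"
      proof (cases "1 < ?w \<and> ?w < 1 + \<epsilon>")
        case True
        then have "V \<omega> > x" "V \<omega> \<le> (1 + \<epsilon>) * x" using x by (auto simp: field_simps)
        moreover have "exp (r * V \<omega>) * exp (- ?w) \<le> exp (r * ((1 + \<epsilon>) * x)) * 1"
          using calculation r w by (intro mult_mono) auto
        ultimately show ?thesis using True \<omega> by (simp add: mult.assoc)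
      next
        case False
        then show ?thesis by (simp only: if_False mult_zero_right) simp
      qed
      finally show "?f \<omega> \<le> exp (r * (1 + \<epsilon>) * x) * indicator ?A \<omega>" .
    qed
    also have "\<dots> = exp (r * (1 + \<epsilon>) * x) * prob ?A"
      by simp
    finally have up: "\<Phi> x \<le> exp (r * (1 + \<epsilon>) * x) * prob ?A" .
    \<comment> \<open>The growth x^2 is given away: only the exponential rate matters.\<close>
    have "S * C / 2 * 1 \<le> S * C / 2 * x\<^sup>2"
      using SC x by (intro mult_left_mono) auto
    also have "\<dots> \<le> \<Phi> x" using elim x by (simp add: field_simps)
    finally have "S * C / 2 \<le> exp (r * (1 + \<epsilon>) * x) * prob ?A" using up by simp
    then have "S * C / 2 * exp (- r * (1 + \<epsilon>) * x) \<le> exp (r * (1 + \<epsilon>) * x) * prob ?A * exp (- r *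
        (1 + \<epsilon>) * x)"
      by (rule mult_right_mono) simp
    also have "\<dots> = prob ?A" by (simp add: exp_minus)
    finally show ?case .
  qed
  then show ?thesis using SC by (intro exI[of _ "S * C / 2"]) auto
qed

lemma (in prob_space) tail_upper_bound:
  assumes [measurable]: "V \<in> borel_measurable M" and "0 < s"
    and mgf: "has_bochner_integral M (\<lambda>\<omega>. exp (s * V \<omega>)) (\<psi> s)"
  shows "prob {\<omega> \<in> space M. V \<omega> > x} \<le> exp (- s * x) * \<psi> s"
proof -
  let ?A = "{\<omega> \<in> space M. V \<omega> > x}"
  have "prob ?A = (\<integral>\<omega>. indicator ?A \<omega> \<partial>M)" by simp
  also have "\<dots> \<le> (\<integral>\<omega>. exp (- s * x) * exp (s * V \<omega>) \<partial>M)"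
  proof (rule integral_mono)
    show "integrable M (\<lambda>\<omega>. exp (- s * x) * exp (s * V \<omega>))"
      using mgf by (intro integrable_mult_right) (simp add: has_bochner_integral_iff)
    fix \<omega>
    show "indicator ?A \<omega> \<le> exp (- s * x) * exp (s * V \<omega>)"
      using \<open>0 < s\<close> by (auto simp: indicator_def simp flip: exp_add)
  qed (auto simp: emeasure_eq_measure)
  also have "\<dots> = exp (- s * x) * \<psi> s"
    using mgf by (simp add: has_bochner_integral_iff)
  finally show ?thesis .
qed

lemma (in prob_space) tail_exponent:
  assumes V: "V \<in> borel_measurable M" "\<And>\<omega>. 0 \<le> V \<omega>" and r: "0 < r" and C: "0 < C"
    and mgf: "\<And>s. 0 < s \<Longrightarrow> s < r \<Longrightarrow> has_bochner_integral M (\<lambda>\<omega>. exp (s * V \<omega>)) (\<psi> s)"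
    and blowup: "((\<lambda>s. (r - s)\<^sup>2 * \<psi> s) \<longlongrightarrow> C) (at_left r)"
  shows "((\<lambda>x. - ln (prob {\<omega> \<in> space M. V \<omega> > x}) / (r * x)) \<longlongrightarrow> 1) at_top"
proof (rule tendstoI)
  fix e :: real assume "0 < e"
  \<comment> \<open>\<delta> < e absorbs the terms of order 1/x on both sides, and \<delta> \<le>
    1/2 keeps the Chernoff exponent s = r (1 - \<delta>) positive.\<close>
  define \<delta> where "\<delta> = min (e / 2) (1 / 2)"
  have \<delta>: "0 < \<delta>" "\<delta> < e" "\<delta> < 1" using \<open>0 < e\<close> by (auto simp: \<delta>_def)
  obtain c where c: "0 < c" and low: "\<forall>\<^sub>F x in at_top. c * exp (- r * (1 + \<delta>) * x) \<le> prob {\<omega> \<in>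
      space M. V \<omega> > x}"
    using tail_lower_bound[OF V r C mgf blowup \<delta>(1)] by blast
  define s where "s = r * (1 - \<delta>)"
  have s: "0 < s" "s < r" using r \<delta> by (auto simp: s_def)
  have "((\<lambda>x. (1 + \<delta>) - ln c / (r * x)) \<longlongrightarrow> 1 + \<delta>) at_top"
    using r by real_asymp
  then have ev1: "\<forall>\<^sub>F x in at_top. (1 + \<delta>) - ln c / (r * x) < 1 + e"
    by (rule order_tendstoD) (use \<delta> in simp)
  have "((\<lambda>x. (1 - \<delta>) - ln (\<psi> s) / (r * x)) \<longlongrightarrow> 1 - \<delta>) at_top"
    using r by real_asymp
  then have ev2: "\<forall>\<^sub>F x in at_top. 1 - e < (1 - \<delta>) - ln (\<psi> s) / (r * x)"
    by (rule order_tendstoD) (use \<delta> in simp)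
  show "\<forall>\<^sub>F x in at_top. dist (- ln (prob {\<omega> \<in> space M. V \<omega> > x}) / (r * x)) 1 < e"
    using low ev1 ev2 eventually_gt_at_top[of 0]
  proof eventually_elim
    case (elim x)
    let ?p = "prob {\<omega> \<in> space M. V \<omega> > x}"
    have rx: "0 < r * x" "x \<noteq> 0" "r \<noteq> 0" using r elim by simp_all
    have p_low: "c * exp (- r * (1 + \<delta>) * x) \<le> ?p" by (rule elim(1))
    moreover have "0 < c * exp (- r * (1 + \<delta>) * x)" using c by simp
    ultimately have p: "0 < ?p" by linarith
    have "ln (c * exp (- r * (1 + \<delta>) * x)) \<le> ln ?p"
      using p_low p c by (subst ln_le_cancel_iff) auto
    then have "- ln ?p \<le> r * (1 + \<delta>) * x - ln c"
      using c by (simp add: ln_mult)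
    then have "- ln ?p / (r * x) \<le> (r * (1 + \<delta>) * x - ln c) / (r * x)"
      using rx by (intro divide_right_mono) auto
    also have "\<dots> = (1 + \<delta>) - ln c / (r * x)"
      using rx by (simp add: diff_divide_distrib)
    also have "\<dots> < 1 + e" by (rule elim(2))
    finally have up: "- ln ?p / (r * x) < 1 + e" .
    have p_up: "?p \<le> exp (- s * x) * \<psi> s"
      by (rule tail_upper_bound[where \<psi>=\<psi>, OF V(1) s(1) mgf[OF s]])
    with p have "0 < exp (- s * x) * \<psi> s" by linarith
    then have \<psi>: "0 < \<psi> s" by (simp add: zero_less_mult_iff)
    have "ln ?p \<le> ln (exp (- s * x) * \<psi> s)"
      using p p_up \<psi> by (subst ln_le_cancel_iff) auto
    then have "r * (1 - \<delta>) * x - ln (\<psi> s) \<le> - ln ?p"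
      using \<psi> by (simp add: ln_mult s_def)
    then have "(r * (1 - \<delta>) * x - ln (\<psi> s)) / (r * x) \<le> - ln ?p / (r * x)"
      using rx by (intro divide_right_mono) auto
    moreover have "(r * (1 - \<delta>) * x - ln (\<psi> s)) / (r * x) = (1 - \<delta>) - ln (\<psi> s) / (r * x)"
      using rx by (simp add: diff_divide_distrib)
    ultimately have "1 - e < - ln ?p / (r * x)"
      using elim(3) by linarith
    with up show ?case by (simp add: dist_real_def abs_less_iff)
  qed
qed

theorem theorem1p1:
  fixes M :: "'a measure"
    and xi :: "nat list \<Rightarrow> nat \<Rightarrow> 'a \<Rightarrow> real \<times> real"
    and W :: "'a \<Rightarrow> real"
  assumes "prob_space M"
    and "\<forall>v. poisson_pp_quadrant M (xi v)"
    and "prob_space.indep_vars M (\<lambda>_. PiM UNIV (\<lambda>_. borel)) (\<lambda>v \<omega> k. xi v k \<omega>) UNIV"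
    and "W \<in> borel_measurable M"
    and "AE \<omega> in M. (\<lambda>n. brw_W xi n \<omega>) \<longlonglongrightarrow> ennreal (W \<omega>)"
  shows "((\<lambda>x. - ln (measure M {\<omega> \<in> space M. W \<omega> > x}) / (r_star * x)) \<longlongrightarrow> 1) at_top"
proof -
  interpret prob_space M by fact
  have fam: "brw_family M xi"
    using assms(2,3) by (simp add: brw_family_def)
  \<comment> \<open>\<open>ennreal\<close> sends negative reals to 0, so the limit determines only
    the positive part of W. Passing to it leaves the events W > x unchanged for x \<ge> 0.\<close>
  define V where "V \<omega> = max 0 (W \<omega>)" for \<omega>
  have V: "V \<in> borel_measurable M" "\<And>\<omega>. 0 \<le> V \<omega>"
    unfolding V_def using assms(4) by auto
  have lim: "AE \<omega> in M. (\<lambda>n. brw_W xi n \<omega>) \<longlonglongrightarrow> ennreal (V \<omega>)"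
    using assms(5) by (auto simp: V_def max_def ennreal_neg)
  have mgf: "has_bochner_integral M (\<lambda>\<omega>. exp (s * V \<omega>)) (exp (cumulant (ln s)))" if "0 < s" "s < r_star" for s
  proof (rule has_bochner_integral_nn_integral)
    show "(\<integral>\<^sup>+\<omega>. ennreal (exp (s * V \<omega>)) \<partial>M) = ennreal (exp (cumulant (ln s)))"
      using brw_limit_mgf[OF assms(1) fam V lim, of "ln s"] that by simp
  qed (use V in auto)
  have "((\<lambda>x. - ln (prob {\<omega> \<in> space M. V \<omega> > x}) / (r_star * x)) \<longlongrightarrow> 1) at_top"
    using r_star_pos by (intro tail_exponent[OF V _ _ mgf cumulant_blowup]) auto
  then show ?thesis
  proof (rule Lim_transform_eventually)
    show "\<forall>\<^sub>F x in at_top. - ln (prob {\<omega> \<in> space M. V \<omega> > x}) / (r_star * x) = - ln (prob {\<omega> \<in> space M. W \<omega> > x}) / (r_star * x)"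
      using eventually_ge_at_top[of 0]
    proof eventually_elim
      case (elim x)
      then have "{\<omega> \<in> space M. V \<omega> > x} = {\<omega> \<in> space M. W \<omega> > x}"
        by (auto simp: V_def)
      then show ?case by simp
    qed
  qed
qed

end
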